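(* Let $\mathcal{L}$ be a finite relational signature all of whose relation symbols have arity $\geq 1$, and let $X$ be a recursive homogeneous $\mathcal{L}$-structure (with domain $\omega$) whose age is dense in $X$. Let $\beta\in \mathrm{Age}(X)$, and let $\beta_0,\beta_1,\beta_2,\ldots$ be a recursive enumeration, without repetition, of the set $[X,\beta]$ of copies of $\beta$ in $X$. For $\alpha=\alpha_0\alpha_1\alpha_2\ldots\in\{0,1\}^\omega$ let $\chi_\alpha:[X,\beta]\to\{0,1\}$ be the colouring $\chi_\alpha(\beta_i)=\alpha_i$. Then for each Kolmogorov–Chaitin complex string $\varepsilon$ there exists an embedding $\nu:X\to X$ such that $\chi_\varepsilon(\beta')=1$ for every $\beta'\in[\nu(X),\beta]$. Moreover, $\nu$ can be constructed so that it is recursive relative to $\varepsilon$.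
   Context: An $\mathcal{L}$-structure $X$ is homogeneous if every isomorphism between finite substructures of $X$ extends to an automorphism of $X$. $\mathrm{Age}(X)$ is the class of all finite $\mathcal{L}$-structures (with domain a finite ordinal) that embed into $X$. The age of $X$ is dense in $X$ if whenever $A,B\in\mathrm{Age}(X)$ and $i:A\to B$ is an embedding, there exist $C\in\mathrm{Age}(X)$ and embeddings $f_1,f_2:B\to C$ with $f_1 i=f_2 i$ and $\mathrm{Im} f_1\cap \mathrm{Im} f_2=\mathrm{Im} f_1 i=\mathrm{Im} f_2 i$. A recursive structure is one with domain $\omega$ in which every relation is a recursive subset of the appropriate $\omega^n$. For $\beta\in\mathrm{Age}(X)$ and a substructure $Y\subseteq X$, $[Y,\beta]$ denotes the set of images of embeddings of $\beta$ into $Y$. For $\alpha\in\{0,1\}^\omega$, $\overline{\alpha}(n)=\alpha_0\cdots\alpha_{n-1}$. Let $H(s)$ denote the prefix-free Kolmogorov complexity of a binary word $s$ (length of a shortest program $p$ with $U(p)=s$ for a fixed universal prefix algorithm $U$, i.e. a universal partial recursive function on binary words with prefix-free domain). An infinite binary string $\varepsilon$ is Kolmogorov–Chaitin complex (a KC-string) if $\exists m\,\forall n\; H(\overline{\varepsilon}(n))\geq n-m$. *)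

theory Defs
  imports Main
begin

datatype recf = CZero | CSucc | CProj nat | CComp recf "recf list" | CPrec recf recf
  | CMn recf | COrc

inductive eval :: "(nat \<Rightarrow> nat) \<Rightarrow> recf \<Rightarrow> nat list \<Rightarrow> nat \<Rightarrow> bool" for orc where
  ev_zero: "eval orc CZero xs 0"
| ev_succ: "xs \<noteq> [] \<Longrightarrow> eval orc CSucc xs (Suc (hd xs))"
| ev_proj: "i < length xs \<Longrightarrow> eval orc (CProj i) xs (xs ! i)"
| ev_comp: "length ys = length gs \<Longrightarrow> (\<forall>j < length gs. eval orc (gs ! j) xs (ys ! j))
             \<Longrightarrow> eval orc f ys z \<Longrightarrow> eval orc (CComp f gs) xs z"
| ev_prec0: "eval orc f xs y \<Longrightarrow> eval orc (CPrec f g) (0 # xs) y"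
| ev_precS: "eval orc (CPrec f g) (n # xs) y \<Longrightarrow> eval orc g (n # y # xs) z
             \<Longrightarrow> eval orc (CPrec f g) (Suc n # xs) z"
| ev_mn: "eval orc f (n # xs) 0 \<Longrightarrow> (\<forall>m < n. \<exists>y. y \<noteq> 0 \<and> eval orc f (m # xs) y)
             \<Longrightarrow> eval orc (CMn f) xs n"
| ev_orc: "xs \<noteq> [] \<Longrightarrow> eval orc COrc xs (orc (hd xs))"

text \<open>Unrelativised computability = computability with the trivial (computable) oracle.\<close>
definition no_oracle :: "nat \<Rightarrow> nat" where "no_oracle = (\<lambda>_. 0)"

definition rec_fun_rel :: "(nat \<Rightarrow> nat) \<Rightarrow> (nat \<Rightarrow> nat) \<Rightarrow> bool" where
  "rec_fun_rel orc f \<longleftrightarrow> (\<exists>t. \<forall>n. eval orc t [n] (f n))"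

definition str_oracle :: "(nat \<Rightarrow> bool) \<Rightarrow> nat \<Rightarrow> nat" where
  "str_oracle a = (\<lambda>m. if a m then 1 else 0)"

definition rec_rel :: "nat \<Rightarrow> (nat list \<Rightarrow> bool) \<Rightarrow> bool" where
  "rec_rel n P \<longleftrightarrow> (\<exists>t. \<forall>xs. length xs = n \<longrightarrow> eval no_oracle t xs (if P xs then 1 else 0))"

text \<open>Bijective coding of binary words by natural numbers (bijective base-2 numeration).\<close>
definition wcode :: "bool list \<Rightarrow> nat" where
  "wcode w = foldr (\<lambda>b n. 2 * n + (if b then 2 else 1)) w 0"

definition partial_rec_word :: "(bool list \<Rightarrow> bool list option) \<Rightarrow> bool" where
  "partial_rec_word V \<longleftrightarrow> (\<exists>t. \<forall>p v. eval no_oracle t [wcode p] v \<longleftrightarrow> (\<exists>y. V p = Some y \<and> v = wcode y))"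

definition prefix_free_dom :: "(bool list \<Rightarrow> bool list option) \<Rightarrow> bool" where
  "prefix_free_dom V \<longleftrightarrow> (\<forall>p r. V p \<noteq> None \<longrightarrow> V (p @ r) \<noteq> None \<longrightarrow> r = [])"

definition prefix_algorithm :: "(bool list \<Rightarrow> bool list option) \<Rightarrow> bool" where
  "prefix_algorithm V \<longleftrightarrow> partial_rec_word V \<and> prefix_free_dom V"

definition universal_prefix :: "(bool list \<Rightarrow> bool list option) \<Rightarrow> bool" where
  "universal_prefix U \<longleftrightarrow> prefix_algorithm U \<and>
     (\<forall>V. prefix_algorithm V \<longrightarrow> (\<exists>c. \<forall>p y. V p = Some y \<longrightarrow>
         (\<exists>q. U q = Some y \<and> length q \<le> length p + c)))"

definition Hc :: "(bool list \<Rightarrow> bool list option) \<Rightarrow> bool list \<Rightarrow> nat" where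
  "Hc U s = (LEAST n. \<exists>p. length p = n \<and> U p = Some s)"

definition init_seg :: "(nat \<Rightarrow> bool) \<Rightarrow> nat \<Rightarrow> bool list" where
  "init_seg a n = map a [0..<n]"

definition KC_string :: "(bool list \<Rightarrow> bool list option) \<Rightarrow> (nat \<Rightarrow> bool) \<Rightarrow> bool" where
  "KC_string U e \<longleftrightarrow> (\<exists>m. \<forall>n. int (Hc U (init_seg e n)) \<ge> int n - int m)"

text \<open>A finite relational signature is a list of arities ar; relation symbol i (i < length ar)
  has arity ar!i. A structure is a pair (domain, interpretation), where the interpretation
  R i xs says that relation i holds of the tuple xs.\<close>
type_synonym struc = "nat set \<times> (nat \<Rightarrow> nat list \<Rightarrow> bool)"

definition is_struc :: "nat list \<Rightarrow> struc \<Rightarrow> bool" where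
  "is_struc ar A \<longleftrightarrow> (\<forall>i xs. snd A i xs \<longrightarrow> i < length ar \<and> length xs = ar ! i \<and> set xs \<subseteq> fst A)"

definition emb :: "nat list \<Rightarrow> struc \<Rightarrow> struc \<Rightarrow> (nat \<Rightarrow> nat) \<Rightarrow> bool" where
  "emb ar A B f \<longleftrightarrow> f ` fst A \<subseteq> fst B \<and> inj_on f (fst A) \<and>
     (\<forall>i < length ar. \<forall>xs. length xs = ar ! i \<longrightarrow> set xs \<subseteq> fst A \<longrightarrow>
        (snd A i xs \<longleftrightarrow> snd B i (map f xs)))"

definition restr :: "struc \<Rightarrow> nat set \<Rightarrow> struc" where
  "restr A Y = (Y, \<lambda>i xs. snd A i xs \<and> set xs \<subseteq> Y)"

definition Age :: "nat list \<Rightarrow> struc \<Rightarrow> struc set" where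
  "Age ar X = {A. (\<exists>k. fst A = {0..<k}) \<and> is_struc ar A \<and> (\<exists>f. emb ar A X f)}"

definition homogeneous :: "nat list \<Rightarrow> struc \<Rightarrow> bool" where
  "homogeneous ar X \<longleftrightarrow> (\<forall>Y1 Y2 g. finite Y1 \<longrightarrow> Y1 \<subseteq> fst X \<longrightarrow> Y2 \<subseteq> fst X \<longrightarrow>
      emb ar (restr X Y1) (restr X Y2) g \<longrightarrow> g ` Y1 = Y2 \<longrightarrow>
      (\<exists>h. bij_betw h (fst X) (fst X) \<and> emb ar X X h \<and> (\<forall>y\<in>Y1. h y = g y)))"

definition age_dense :: "nat list \<Rightarrow> struc \<Rightarrow> bool" where
  "age_dense ar X \<longleftrightarrow> (\<forall>A B i. A \<in> Age ar X \<longrightarrow> B \<in> Age ar X \<longrightarrow> emb ar A B i \<longrightarrow>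
      (\<exists>C f1 f2. C \<in> Age ar X \<and> emb ar B C f1 \<and> emb ar B C f2 \<and>
         (\<forall>a\<in>fst A. f1 (i a) = f2 (i a)) \<and>
         f1 ` fst B \<inter> f2 ` fst B = f1 ` i ` fst A \<and>
         f1 ` i ` fst A = f2 ` i ` fst A))"

definition recursive_struc :: "nat list \<Rightarrow> struc \<Rightarrow> bool" where
  "recursive_struc ar X \<longleftrightarrow> fst X = UNIV \<and> (\<forall>i < length ar. rec_rel (ar ! i) (snd X i))"

definition copies :: "nat list \<Rightarrow> struc \<Rightarrow> nat set \<Rightarrow> struc \<Rightarrow> nat set set" where
  "copies ar X Y b = {f ` fst b | f. emb ar b (restr X Y) f}"

definition fset_code :: "nat set \<Rightarrow> nat" where
  "fset_code S = (\<Sum>x\<in>S. 2 ^ x)"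

definition rec_enum_norep :: "(nat \<Rightarrow> nat set) \<Rightarrow> nat set set \<Rightarrow> bool" where
  "rec_enum_norep e F \<longleftrightarrow> bij_betw e UNIV F \<and> (\<forall>n. finite (e n)) \<and>
     rec_fun_rel no_oracle (\<lambda>n. fset_code (e n))"

end

theory Submission
  imports Defs Complex_Main "HOL-Library.Nat_Bijection"
begin

text \<open>
  The embedding is built point by point. Suppose that \<open>0, \<dots>, k - 1\<close> have been mapped to a finite
  set \<open>Y\<close>. By homogeneity and density of the age, the type that the image of \<open>k\<close> must have over
  \<open>Y\<close> is realized by infinitely many points \<open>x\<close>. Each of them brings at most \<open>2 ^ (k + 1)\<close> new
  copies of \<open>b\<close>, all of which contain \<open>x\<close>, so that the sets of indices of new copies are pairwise
  disjoint for distinct \<open>x\<close>. If each of these sets contained an index of colour 0, then the initial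
  segments of \<open>\<epsilon>\<close> would have a 0 in each of arbitrarily many disjoint sets of bounded size. For
  \<open>s\<close> sets of size at most \<open>t\<close> only a fraction of at most \<open>(1 - 2 ^ (- t)) ^ s\<close> of all words has
  this property, and naming such a word by its rank among them compresses it by more than any
  given constant. So for a complex string some \<open>x\<close> has all its new
  copies coloured 1, and it can be found by a search that is recursive in \<open>\<epsilon>\<close>.
\<close>

section \<open>Closure properties of the recursive functions\<close>

lemma eval_CComp1:
  "\<lbrakk>eval orc g xs y; eval orc f [y] z\<rbrakk> \<Longrightarrow> eval orc (CComp f [g]) xs z"
  by (rule ev_comp[where ys = "[y]"]) auto

lemma eval_CComp2:
  "\<lbrakk>eval orc g xs y; eval orc h xs y'; eval orc f [y, y'] z\<rbrakk> \<Longrightarrow> eval orc (CComp f [g, h]) xs z"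
  by (rule ev_comp[where ys = "[y, y']"]) (auto simp: less_Suc_eq nth_Cons')

inductive_cases eval_CZeroE: "eval orc CZero xs v"
inductive_cases eval_CSuccE: "eval orc CSucc xs v"
inductive_cases eval_CProjE: "eval orc (CProj i) xs v"
inductive_cases eval_CCompE: "eval orc (CComp f gs) xs v"
inductive_cases eval_CPrec0E: "eval orc (CPrec f g) (0 # xs) v"
inductive_cases eval_CPrecSE: "eval orc (CPrec f g) (Suc n # xs) v"
inductive_cases eval_CMnE: "eval orc (CMn f) xs v"
inductive_cases eval_COrcE: "eval orc COrc xs v"

text \<open>Used wherever the exact graph of a program matters. For \<open>CMn\<close>, the smaller
  of two distinct results would be an argument at which \<open>f\<close> has both the value 0 and a
  nonzero value.\<close>

lemma eval_deterministic: "eval orc t xs v \<Longrightarrow> eval orc t xs v' \<Longrightarrow> v = v'"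
proof (induction arbitrary: v' rule: eval.induct)
  case (ev_comp ys gs xs f z)
  from ev_comp.prems obtain ys' where ys': "length ys' = length gs"
    "\<forall>j<length gs. eval orc (gs ! j) xs (ys' ! j)" "eval orc f ys' v'"
    by (auto elim: eval_CCompE)
  have "ys = ys'"
    using ev_comp.hyps(1) ys' ev_comp.IH by (intro nth_equalityI) auto
  with ys' ev_comp.IH show ?case by auto
next
  case (ev_precS f g n xs y z)
  then show ?case by (metis eval_CPrecSE)
next
  case (ev_mn f n xs)
  from ev_mn.prems have v': "eval orc f (v' # xs) 0"
    "\<forall>m<v'. \<exists>y. y \<noteq> 0 \<and> eval orc f (m # xs) y"
    by (auto elim: eval_CMnE)
  show ?case
  proof (rule linorder_cases)
    assume "n < v'"
    with v' ev_mn.IH show ?thesis by metis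
  next
    assume "v' < n"
    with v' ev_mn.IH show ?thesis by metis
  qed
next
  case (ev_prec0 f xs y g)
  then show ?case by (metis eval_CPrec0E)
qed (erule eval_CZeroE eval_CSuccE eval_CProjE eval_COrcE, simp)+

text \<open>\<open>no_oracle\<close> answers 0 to every query, so \<open>CZero\<close> can stand in
  for \<open>COrc\<close>. The new program ignores its oracle and hence also runs relative to
  \<epsilon>.\<close>

fun drop_oracle :: "recf \<Rightarrow> recf" where
  "drop_oracle (CComp f gs) = CComp (drop_oracle f) (map drop_oracle gs)"
| "drop_oracle (CPrec f g) = CPrec (drop_oracle f) (drop_oracle g)"
| "drop_oracle (CMn f) = CMn (drop_oracle f)"
| "drop_oracle COrc = CZero"
| "drop_oracle t = t"

lemma eval_drop_oracle: "eval no_oracle t xs v \<Longrightarrow> eval orc (drop_oracle t) xs v"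
proof (induction rule: eval.induct)
  case (ev_comp ys gs xs f z)
  then show ?case by (auto intro!: eval.ev_comp[where ys = ys])
next
  case (ev_mn f n xs)
  then show ?case by (auto intro!: eval.ev_mn)
next
  case (ev_orc xs)
  then show ?case by (simp add: no_oracle_def eval.ev_zero)
qed (simp_all add: eval.ev_zero eval.ev_succ eval.ev_proj eval.ev_prec0 eval.ev_precS)

section \<open>Total functions of fixed arity\<close>

definition recs :: "(nat \<Rightarrow> nat) \<Rightarrow> nat \<Rightarrow> (nat list \<Rightarrow> nat) \<Rightarrow> bool" where
  "recs orc n F \<longleftrightarrow> (\<exists>t. \<forall>xs. length xs = n \<longrightarrow> eval orc t xs (F xs))"

lemma recs_proj: "i < n \<Longrightarrow> recs orc n (\<lambda>xs. xs ! i)"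
  unfolding recs_def by (metis ev_proj)

lemma recs_zero: "recs orc n (\<lambda>xs. 0)"
  unfolding recs_def by (metis ev_zero)

lemma recs_comp1:
  assumes "recs orc 1 (\<lambda>xs. h (xs ! 0))" "recs orc n F"
  shows "recs orc n (\<lambda>xs. h (F xs))"
proof -
  obtain t s where "\<forall>xs. length xs = 1 \<longrightarrow> eval orc t xs (h (xs ! 0))"
    and "\<forall>xs. length xs = n \<longrightarrow> eval orc s xs (F xs)"
    using assms unfolding recs_def by blast
  then have "eval orc (CComp t [s]) xs (h (F xs))" if "length xs = n" for xs
    using that by (intro eval_CComp1) (auto dest: spec[of _ "[F xs]"])
  then show ?thesis unfolding recs_def by blast
qed

lemma recs_comp2:
  assumes "recs orc 2 (\<lambda>xs. h (xs ! 0) (xs ! 1))" "recs orc n F" "recs orc n G"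
  shows "recs orc n (\<lambda>xs. h (F xs) (G xs))"
proof -
  obtain t s s' where "\<forall>xs. length xs = 2 \<longrightarrow> eval orc t xs (h (xs ! 0) (xs ! 1))"
    and "\<forall>xs. length xs = n \<longrightarrow> eval orc s xs (F xs)"
    and "\<forall>xs. length xs = n \<longrightarrow> eval orc s' xs (G xs)"
    using assms unfolding recs_def by blast
  then have "eval orc (CComp t [s, s']) xs (h (F xs) (G xs))" if "length xs = n" for xs
    using that by (intro eval_CComp2) (auto dest: spec[of _ "[F xs, G xs]"])
  then show ?thesis unfolding recs_def by blast
qed

lemma recs_rec_nat:
  assumes "recs orc 1 (\<lambda>xs. a (xs ! 0))" "recs orc 3 (\<lambda>xs. g (xs ! 0) (xs ! 1) (xs ! 2))"
  shows "recs orc 2 (\<lambda>xs. rec_nat (a (xs ! 1)) (\<lambda>i v. g i v (xs ! 1)) (xs ! 0))"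
proof -
  obtain t s where t: "\<And>xs. length xs = 1 \<Longrightarrow> eval orc t xs (a (xs ! 0))"
    and s: "\<And>xs. length xs = 3 \<Longrightarrow> eval orc s xs (g (xs ! 0) (xs ! 1) (xs ! 2))"
    using assms unfolding recs_def by blast
  have *: "eval orc (CPrec t s) [n, y] (rec_nat (a y) (\<lambda>i v. g i v y) n)" for n y
  proof (induction n)
    case 0
    show ?case using t[of "[y]"] by (auto intro: ev_prec0)
  next
    case (Suc n)
    then show ?case using s[of "[n, _, y]"] by (auto intro!: ev_precS)
  qed
  have "eval orc (CPrec t s) xs (rec_nat (a (xs ! 1)) (\<lambda>i v. g i v (xs ! 1)) (xs ! 0))"
    if "length xs = 2" for xs
  proof -
    from that obtain x y where "xs = [x, y]"
      by (metis (no_types, opaque_lifting) One_nat_def Suc_1 length_0_conv length_Suc_conv)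
    with * show ?thesis by simp
  qed
  then show ?thesis unfolding recs_def by blast
qed

lemma recs_Suc: "recs orc 1 (\<lambda>xs. Suc (xs ! 0))"
  unfolding recs_def
  by (rule exI[of _ CSucc]) (metis ev_succ hd_conv_nth length_0_conv zero_neq_one)

lemma recs_const: "recs orc n (\<lambda>xs. c)"
  by (induction c) (simp_all add: recs_zero recs_comp1[OF recs_Suc])

lemma recs_add: "recs orc 2 (\<lambda>xs. xs ! 0 + xs ! 1)"
proof -
  have "rec_nat y (\<lambda>i v. Suc v) x = x + y" for x y :: nat
    by (induction x) auto
  with recs_rec_nat[where a = "\<lambda>y. y" and g = "\<lambda>i v y. Suc v", of orc] show ?thesis
    by (simp add: recs_proj recs_comp1[OF recs_Suc])
qed

lemma recs_pred: "recs orc 1 (\<lambda>xs. xs ! 0 - 1)"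
proof -
  have "rec_nat (0::nat) (\<lambda>i v. i) x = x - 1" for x by (cases x) auto
  with recs_rec_nat[where a = "\<lambda>y. 0" and g = "\<lambda>i v y. i", of orc]
  have "recs orc 2 (\<lambda>xs. (\<lambda>x y. x - 1) (xs ! 0) (xs ! 1))"
    by (simp add: recs_proj recs_const)
  \<comment> \<open>The recursion scheme yields a binary function; passing the same argument twice
    removes the dummy parameter.\<close>
  from recs_comp2[OF this recs_proj[of 0 1] recs_proj[of 0 1]] show ?thesis by simp
qed

lemma recs_diff: "recs orc 2 (\<lambda>xs. xs ! 0 - xs ! 1)"
proof -
  \<comment> \<open>The recursion runs on the subtrahend, so the arguments come out swapped; the
    projections at the end swap them back.\<close>
  have "rec_nat y (\<lambda>i v. v - 1) x = y - x" for x y :: nat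
    by (induction x) auto
  with recs_rec_nat[where a = "\<lambda>y. y" and g = "\<lambda>i v y. v - 1", of orc]
  have "recs orc 2 (\<lambda>xs. (\<lambda>x y. y - x) (xs ! 0) (xs ! 1))"
    using recs_comp1[OF recs_pred, of orc 3 "\<lambda>xs. xs ! 1"]
    by (simp add: recs_proj)
  from recs_comp2[OF this recs_proj[of 1 2] recs_proj[of 0 2]] show ?thesis by simp
qed

lemma recs_triangle: "recs orc 1 (\<lambda>xs. triangle (xs ! 0))"
proof -
  have "rec_nat 0 (\<lambda>i v. v + Suc i) x = triangle x" for x
    by (induction x) auto
  with recs_rec_nat[where a = "\<lambda>y. 0" and g = "\<lambda>i v y. v + Suc i", of orc]
  have "recs orc 2 (\<lambda>xs. (\<lambda>x y. triangle x) (xs ! 0) (xs ! 1))"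
    using recs_comp2[OF recs_add, of orc 3 "\<lambda>xs. xs ! 1" "\<lambda>xs. Suc (xs ! 0)"]
    by (simp add: recs_proj recs_const recs_comp1[OF recs_Suc])
  from recs_comp2[OF this recs_proj[of 0 1] recs_proj[of 0 1]] show ?thesis by simp
qed

lemma recs_LEAST:
  assumes "recs orc 2 (\<lambda>xs. g (xs ! 0) (xs ! 1))" and ex: "\<And>y. \<exists>x. g x y = (0::nat)"
  shows "recs orc 1 (\<lambda>xs. LEAST x. g x (xs ! 0) = 0)"
proof -
  obtain t where t: "\<And>xs. length xs = 2 \<Longrightarrow> eval orc t xs (g (xs ! 0) (xs ! 1))"
    using assms unfolding recs_def by blast
  have "eval orc (CMn t) xs (LEAST x. g x (xs ! 0) = 0)" if "length xs = 1" for xs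
  proof -
    from that obtain y where xs: "xs = [y]"
      by (metis One_nat_def length_0_conv length_Suc_conv)
    have t': "eval orc t [x, y] (g x y)" for x using t[of "[x, y]"] by simp
    show ?thesis unfolding xs
    proof (rule ev_mn)
      show "eval orc t ((LEAST x. g x ([y] ! 0) = 0) # [y]) 0"
        using t' LeastI_ex[OF ex[of y]] by (metis nth_Cons_0)
      show "\<forall>m<LEAST x. g x ([y] ! 0) = 0. \<exists>v. v \<noteq> 0 \<and> eval orc t (m # [y]) v"
        using t' by (auto dest: not_less_Least)
    qed
  qed
  then show ?thesis unfolding recs_def by blast
qed

subsection \<open>Unary functions and pairing\<close>

lemma rec_fun_rel_iff: "rec_fun_rel orc f \<longleftrightarrow> recs orc 1 (\<lambda>xs. f (xs ! 0))"
proof -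
  have "(\<forall>n. eval orc t [n] (f n)) \<longleftrightarrow> (\<forall>xs. length xs = 1 \<longrightarrow> eval orc t xs (f (xs ! 0)))" for t
    by (auto simp: length_Suc_conv dest: spec[of _ "[_]"])
  then show ?thesis unfolding rec_fun_rel_def recs_def by blast
qed

definition pair :: "nat \<Rightarrow> nat \<Rightarrow> nat" where
  "pair x y = prod_encode (x, y)"

definition pfst :: "nat \<Rightarrow> nat" where
  "pfst p = fst (prod_decode p)"

definition psnd :: "nat \<Rightarrow> nat" where
  "psnd p = snd (prod_decode p)"

lemma pfst_pair [simp]: "pfst (pair x y) = x"
  and psnd_pair [simp]: "psnd (pair x y) = y"
  by (simp_all add: pair_def pfst_def psnd_def)

lemma triangle_mono: "m \<le> n \<Longrightarrow> triangle m \<le> triangle n"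
  by (rule lift_Suc_mono_le) auto

text \<open>The code of \<open>(x, y)\<close> is \<open>triangle (x + y) + x\<close>, which lies
  below \<open>triangle (Suc (x + y))\<close>. A search for the diagonal thus recovers
  \<open>x + y\<close>, and from it both projections.\<close>

lemma triangle_root:
  assumes "p = pair x y"
  shows "(LEAST r. Suc p - triangle (Suc r) = 0) = x + y"
proof (rule Least_equality)
  show "Suc p - triangle (Suc (x + y)) = 0"
    using assms by (simp add: pair_def prod_encode_def)
  fix r assume r: "Suc p - triangle (Suc r) = 0"
  show "x + y \<le> r"
  proof (rule ccontr)
    assume "\<not> x + y \<le> r"
    then have "triangle (Suc r) \<le> triangle (x + y)" by (intro triangle_mono) simp
    with r assms show False by (simp add: pair_def prod_encode_def)
  qed
qed

lemma rec_id [intro!]: "rec_fun_rel orc (\<lambda>n. n)"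
  and rec_const [intro!]: "rec_fun_rel orc (\<lambda>n. c)"
  by (simp_all add: rec_fun_rel_iff recs_proj recs_const)

lemma rec_comp: "rec_fun_rel orc h \<Longrightarrow> rec_fun_rel orc f \<Longrightarrow> rec_fun_rel orc (\<lambda>n. h (f n))"
  unfolding rec_fun_rel_iff by (rule recs_comp1)

lemma rec_Suc [intro!]: "rec_fun_rel orc f \<Longrightarrow> rec_fun_rel orc (\<lambda>n. Suc (f n))"
  unfolding rec_fun_rel_iff by (rule recs_comp1[OF recs_Suc])

lemma rec_add [intro!]:
  "rec_fun_rel orc f \<Longrightarrow> rec_fun_rel orc g \<Longrightarrow> rec_fun_rel orc (\<lambda>n. f n + g n)"
  unfolding rec_fun_rel_iff by (rule recs_comp2[OF recs_add])

lemma rec_diff [intro!]: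
  "rec_fun_rel orc f \<Longrightarrow> rec_fun_rel orc g \<Longrightarrow> rec_fun_rel orc (\<lambda>n. f n - g n)"
  unfolding rec_fun_rel_iff by (rule recs_comp2[OF recs_diff])

lemma rec_triangle: "rec_fun_rel orc f \<Longrightarrow> rec_fun_rel orc (\<lambda>n. triangle (f n))"
  unfolding rec_fun_rel_iff by (rule recs_comp1[OF recs_triangle])

lemma rec_pair [intro!]:
  "rec_fun_rel orc f \<Longrightarrow> rec_fun_rel orc g \<Longrightarrow> rec_fun_rel orc (\<lambda>n. pair (f n) (g n))"
  unfolding pair_def prod_encode_def by (simp add: rec_add rec_triangle)

lemma ex_pair: "\<exists>x y. p = pair x y"
  by (metis pair_def prod.collapse prod_decode_inverse)

lemma rec_psum: "rec_fun_rel orc (\<lambda>p. pfst p + psnd p)"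
proof -
  have "recs orc 2 (\<lambda>xs. Suc (xs ! 1) - triangle (Suc (xs ! 0)))"
    by (rule recs_comp2[OF recs_diff] recs_comp1[OF recs_Suc] recs_comp1[OF recs_triangle]
        recs_proj | simp)+
  then have "recs orc 1 (\<lambda>xs. LEAST r. (\<lambda>r p. Suc p - triangle (Suc r)) r (xs ! 0) = 0)"
  proof (rule recs_LEAST)
    show "\<exists>x. Suc y - triangle (Suc x) = 0" for y
      by (rule exI[of _ y]) simp
  qed
  moreover have "(LEAST r. Suc p - triangle (Suc r) = 0) = pfst p + psnd p" for p
    using ex_pair[of p] triangle_root by auto
  ultimately show ?thesis by (simp add: rec_fun_rel_iff)
qed

lemma rec_pfst [intro!]: "rec_fun_rel orc f \<Longrightarrow> rec_fun_rel orc (\<lambda>n. pfst (f n))"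
proof (rule rec_comp[of orc pfst])
  have "pair x y - triangle (x + y) = x" for x y
    by (simp add: pair_def prod_encode_def)
  then have "pfst p = p - triangle (pfst p + psnd p)" for p
    using ex_pair[of p] by auto
  then have "pfst = (\<lambda>p. p - triangle (pfst p + psnd p))" by blast
  then show "rec_fun_rel orc pfst"
    using rec_diff[OF rec_id rec_triangle[OF rec_psum]] by metis
qed

lemma rec_psnd [intro!]: "rec_fun_rel orc f \<Longrightarrow> rec_fun_rel orc (\<lambda>n. psnd (f n))"
proof (rule rec_comp[of orc psnd])
  have "rec_fun_rel orc (\<lambda>p. (pfst p + psnd p) - pfst p)"
    by (intro rec_diff rec_psum rec_pfst rec_id)
  then show "rec_fun_rel orc psnd" by simp
qed

lemma recs_of_rec1: "rec_fun_rel orc h \<Longrightarrow> recs orc n F \<Longrightarrow> recs orc n (\<lambda>xs. h (F xs))"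
  unfolding rec_fun_rel_iff by (rule recs_comp1)

lemma recs_pair: "recs orc n F \<Longrightarrow> recs orc n G \<Longrightarrow> recs orc n (\<lambda>xs. pair (F xs) (G xs))"
  unfolding pair_def prod_encode_def
  by (simp add: recs_comp2[OF recs_add] recs_comp1[OF recs_triangle])

text \<open>A function of several arguments counts as recursive if it is so in the code of its
  argument tuple. In this form the closure rules apply under binders, with the outer variable as a
  parameter.\<close>

lemma rec_rec_nat [intro!]:
  assumes B: "rec_fun_rel orc B" and A: "rec_fun_rel orc A"
    and G: "rec_fun_rel orc (\<lambda>p. G (pfst p) (pfst (psnd p)) (psnd (psnd p)))"
  shows "rec_fun_rel orc (\<lambda>n. rec_nat (A n) (\<lambda>i v. G n i v) (B n))"
proof -
  have "recs orc 3 (\<lambda>xs. G (xs ! 2) (xs ! 0) (xs ! 1))"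
    using recs_of_rec1[OF G, of 3 "\<lambda>xs. pair (xs ! 2) (pair (xs ! 0) (xs ! 1))"]
    by (simp add: recs_pair recs_proj)
  from recs_rec_nat[of orc A "\<lambda>i v y. G y i v", OF A[unfolded rec_fun_rel_iff] this]
  have "recs orc 2 (\<lambda>xs. (\<lambda>x y. rec_nat (A y) (G y) x) (xs ! 0) (xs ! 1))" by simp
  from recs_comp2[OF this, of 1 "\<lambda>xs. B (xs ! 0)" "\<lambda>xs. xs ! 0"] B show ?thesis
    by (simp add: rec_fun_rel_iff recs_proj)
qed

lemma rec_LEAST_zero:
  assumes G: "rec_fun_rel orc (\<lambda>p. G (pfst p) (psnd p))" and "\<And>n. \<exists>x. G n x = (0::nat)"
  shows "rec_fun_rel orc (\<lambda>n. LEAST x. G n x = 0)"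
proof -
  have "recs orc 2 (\<lambda>xs. G (xs ! 1) (xs ! 0))"
    using recs_of_rec1[OF G, of 2 "\<lambda>xs. pair (xs ! 1) (xs ! 0)"]
    by (simp add: recs_pair recs_proj)
  from recs_LEAST[of orc "\<lambda>x y. G y x", OF this] assms(2) show ?thesis
    by (simp add: rec_fun_rel_iff)
qed

lemma rec_mult [intro!]:
  assumes "rec_fun_rel orc f" "rec_fun_rel orc g"
  shows "rec_fun_rel orc (\<lambda>n. f n * g n)"
proof -
  have "rec_nat 0 (\<lambda>i v. v + y) x = x * y" for x y :: nat
    by (induction x) auto
  moreover have "rec_fun_rel orc (\<lambda>n. rec_nat 0 (\<lambda>i v. v + g n) (f n))"
    by (intro rec_rec_nat assms rec_const rec_add rec_pfst rec_psnd rec_id rec_comp[OF assms(2)])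
  ultimately show ?thesis by simp
qed

lemma rec_power [intro!]:
  assumes "rec_fun_rel orc f" "rec_fun_rel orc g"
  shows "rec_fun_rel orc (\<lambda>n. f n ^ g n)"
proof -
  have "rec_nat 1 (\<lambda>i v. y * v) x = y ^ x" for x y :: nat
    by (induction x) auto
  moreover have "rec_fun_rel orc (\<lambda>n. rec_nat 1 (\<lambda>i v. f n * v) (g n))"
    by (intro rec_rec_nat assms rec_const rec_mult rec_pfst rec_psnd rec_id rec_comp[OF assms(1)])
  ultimately show ?thesis by simp
qed

lemma rec_sum [intro!]:
  assumes "rec_fun_rel orc B" "rec_fun_rel orc (\<lambda>p. F (pfst p) (psnd p))"
  shows "rec_fun_rel orc (\<lambda>n. \<Sum>i<B n. F n i)"
proof -
  have "rec_nat 0 (\<lambda>i v. v + F n i) x = (\<Sum>i<x. F n i)" for x n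
    by (induction x) auto
  moreover have "rec_fun_rel orc (\<lambda>n. rec_nat 0 (\<lambda>i v. v + F n i) (B n))"
    using rec_comp[OF assms(2) rec_pair[OF rec_pfst[OF rec_id] rec_pfst[OF rec_psnd[OF rec_id]]]]
    by (intro rec_rec_nat assms rec_const rec_add rec_pfst rec_psnd rec_id) simp
  ultimately show ?thesis by simp
qed

subsection \<open>Decidable predicates\<close>

definition decp :: "(nat \<Rightarrow> nat) \<Rightarrow> (nat \<Rightarrow> bool) \<Rightarrow> bool" where
  "decp orc P \<longleftrightarrow> rec_fun_rel orc (\<lambda>n. of_bool (P n))"

lemma rec_of_bool [intro!]: "decp orc P \<Longrightarrow> rec_fun_rel orc (\<lambda>n. of_bool (P n))"
  unfolding decp_def .

lemma decp_comp: "decp orc P \<Longrightarrow> rec_fun_rel orc f \<Longrightarrow> decp orc (\<lambda>n. P (f n))"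
  unfolding decp_def by (rule rec_comp)

lemma decp_not [intro!]: "decp orc P \<Longrightarrow> decp orc (\<lambda>n. \<not> P n)"
proof -
  assume "decp orc P"
  moreover have "of_bool (\<not> P n) = (1::nat) - of_bool (P n)" for n by simp
  ultimately show ?thesis unfolding decp_def by (simp only:) (intro rec_diff rec_const)
qed

lemma decp_conj [intro!]: "decp orc P \<Longrightarrow> decp orc Q \<Longrightarrow> decp orc (\<lambda>n. P n \<and> Q n)"
  unfolding decp_def of_bool_conj by (rule rec_mult)

lemma decp_imp [intro!]: "decp orc P \<Longrightarrow> decp orc Q \<Longrightarrow> decp orc (\<lambda>n. P n \<longrightarrow> Q n)"
  using decp_not[OF decp_conj[of orc P "\<lambda>n. \<not> Q n"]] by (simp add: decp_not)

lemma decp_iff [intro!]: "decp orc P \<Longrightarrow> decp orc Q \<Longrightarrow> decp orc (\<lambda>n. P n \<longleftrightarrow> Q n)"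
  unfolding iff_conv_conj_imp by (intro decp_conj decp_imp)

lemma decp_le [intro!]:
  assumes "rec_fun_rel orc f" "rec_fun_rel orc g"
  shows "decp orc (\<lambda>n. f n \<le> g n)"
proof -
  have "of_bool (f n \<le> g n) = 1 - (f n - g n)" for n by simp
  then show ?thesis unfolding decp_def by (simp only:) (intro rec_diff rec_const assms)
qed

lemma decp_less [intro!]:
  assumes "rec_fun_rel orc f" "rec_fun_rel orc g"
  shows "decp orc (\<lambda>n. f n < g n)"
  using decp_le[OF rec_Suc[OF assms(1)] assms(2)] by (simp add: Suc_le_eq)

lemma decp_eq [intro!]:
  assumes "rec_fun_rel orc f" "rec_fun_rel orc g"
  shows "decp orc (\<lambda>n. f n = g n)"
  unfolding order_eq_iff by (intro decp_conj decp_le assms)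

lemma decp_const [intro!]: "decp orc (\<lambda>n. c)"
  unfolding decp_def by (rule rec_const)

lemma decp_bex [intro!]:
  assumes "rec_fun_rel orc B" "decp orc (\<lambda>p. P (pfst p) (psnd p))"
  shows "decp orc (\<lambda>n. \<exists>i<B n. P n i)"
proof -
  have "(\<exists>i<B n. P n i) \<longleftrightarrow> 0 < (\<Sum>i<B n. of_bool (P n i) :: nat)" for n
    by (auto simp: zero_less_iff_neq_zero simp del: sum_of_bool_eq)
  then show ?thesis
    by (simp only:) (intro decp_less rec_const rec_sum rec_of_bool assms)
qed

lemma decp_ball [intro!]:
  assumes "rec_fun_rel orc B" "decp orc (\<lambda>p. P (pfst p) (psnd p))"
  shows "decp orc (\<lambda>n. \<forall>i<B n. P n i)"
  using decp_not[OF decp_bex[OF assms(1) decp_not[OF assms(2)]]] by simp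

lemma rec_LEAST [intro!]:
  assumes "decp orc (\<lambda>p. P (pfst p) (psnd p))" "\<And>n. \<exists>x. P n x"
  shows "rec_fun_rel orc (\<lambda>n. LEAST x. P n x)"
proof -
  have "rec_fun_rel orc (\<lambda>n. LEAST x. (1::nat) - of_bool (P n x) = 0)"
  proof (rule rec_LEAST_zero)
    show "rec_fun_rel orc (\<lambda>p. 1 - of_bool (P (pfst p) (psnd p)))"
      using assms by auto
    show "\<exists>x. (1::nat) - of_bool (P n x) = 0" for n
      using assms(2)[of n] by auto
  qed
  moreover have "(1::nat) - of_bool b = 0 \<longleftrightarrow> b" for b by auto
  ultimately show ?thesis by simp
qed

lemma rec_div [intro!]:
  assumes "rec_fun_rel orc f" "rec_fun_rel orc g"
  shows "rec_fun_rel orc (\<lambda>n. f n div g n)"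
proof -
  \<comment> \<open>The disjunct \<open>b = 0\<close> lets the search succeed at 0, in accordance
    with \<open>a div 0 = 0\<close>.\<close>
  have "(LEAST q. b = 0 \<or> a < b * Suc q) = a div b" for a b :: nat
  proof (cases "b = 0")
    case False
    then show ?thesis
      by (intro Least_equality)
        (auto simp: dividend_less_times_div less_Suc_eq_le[symmetric] less_mult_imp_div_less mult.commute)
  qed auto
  moreover have "rec_fun_rel orc (\<lambda>n. LEAST q. \<not> (g n \<noteq> 0 \<and> \<not> f n < g n * Suc q))"
  proof (rule rec_LEAST)
    show "decp orc (\<lambda>p. \<not> (g (pfst p) \<noteq> 0 \<and> \<not> f (pfst p) < g (pfst p) * Suc (psnd p)))"
      by (intro decp_not decp_conj decp_eq decp_less rec_mult rec_Suc rec_psnd rec_id rec_const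
          rec_pfst rec_comp[OF assms(1)] rec_comp[OF assms(2)])
    fix n show "\<exists>x. \<not> (g n \<noteq> 0 \<and> \<not> f n < g n * Suc x)"
      by (rule exI[of _ "f n"]) (cases "g n", auto)
  qed
  ultimately show ?thesis by simp
qed

lemma rec_mod [intro!]:
  assumes "rec_fun_rel orc f" "rec_fun_rel orc g"
  shows "rec_fun_rel orc (\<lambda>n. f n mod g n)"
  unfolding modulo_nat_def by (intro rec_diff rec_mult rec_div assms)

lemma decp_odd [intro!]: "rec_fun_rel orc f \<Longrightarrow> decp orc (\<lambda>n. odd (f n))"
  unfolding odd_iff_mod_2_eq_one by (intro decp_eq rec_mod rec_const)

section \<open>Recursive relations and unbounded search\<close>

lemma rec_no_oracle: "rec_fun_rel no_oracle f \<Longrightarrow> rec_fun_rel orc f"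
  unfolding rec_fun_rel_def by (blast intro: eval_drop_oracle)

text \<open>The arity is a fixed number, so finitely many programs, one for each entry of the tuple,
  are composed with the program for \<open>P\<close>.\<close>

lemma decp_rec_rel:
  assumes P: "rec_rel a P" and f: "rec_fun_rel orc (\<lambda>p. f (pfst p) (psnd p))"
  shows "decp orc (\<lambda>n. P (map (\<lambda>j. f n j) [0..<a]))"
proof -
  obtain t where t: "\<And>xs. length xs = a \<Longrightarrow> eval no_oracle t xs (if P xs then 1 else 0)"
    using P unfolding rec_rel_def by blast
  have "\<exists>s. \<forall>n. eval orc s [n] (f n j)" for j
    using rec_comp[OF f rec_pair[OF rec_id rec_const]] by (simp add: rec_fun_rel_def)
  then obtain s where s: "\<And>j n. eval orc (s j) [n] (f n j)" by metis
  have "eval orc (CComp (drop_oracle t) (map s [0..<a])) [n]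
          (of_bool (P (map (\<lambda>j. f n j) [0..<a])))" for n
  proof (rule ev_comp)
    show "eval orc (drop_oracle t) (map (f n) [0..<a]) (of_bool (P (map (\<lambda>j. f n j) [0..<a])))"
      using eval_drop_oracle[OF t, of "map (f n) [0..<a]"] by (simp add: of_bool_def)
  qed (auto simp: s)
  then show ?thesis unfolding decp_def rec_fun_rel_def by blast
qed

text \<open>The search may diverge: the program halts on \<open>n\<close> only if some
  \<open>v\<close> satisfies \<open>Q n v\<close>. This is the source of partial recursive
  functions, in particular of the machine \<open>V\<close> below.\<close>

lemma decp_search:
  assumes "decp orc (\<lambda>p. Q (pfst p) (psnd p))"
  shows "\<exists>t. \<forall>n v. eval orc t [n] v \<longleftrightarrow> Q n v \<and> (\<forall>m<v. \<not> Q n m)"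
proof -
  have "rec_fun_rel orc (\<lambda>p. 1 - of_bool (Q (pfst p) (psnd p)))"
    using assms by auto
  from recs_of_rec1[OF this, of 2 "\<lambda>xs. pair (xs ! 1) (xs ! 0)"]
  have "recs orc 2 (\<lambda>xs. 1 - of_bool (Q (xs ! 1) (xs ! 0)))"
    by (simp add: recs_pair recs_proj)
  then obtain s where "\<And>xs. length xs = 2 \<Longrightarrow> eval orc s xs (1 - of_bool (Q (xs ! 1) (xs ! 0)))"
    unfolding recs_def by blast
  from this[of "[_, _]"] have s: "eval orc s [m, n] (1 - of_bool (Q n m))" for m n by simp
  have s_iff: "eval orc s [m, n] y \<longleftrightarrow> y = (if Q n m then 0 else 1)" for m n y
    using s[of m n] eval_deterministic by (auto split: if_splits)
  have "eval orc (CMn s) [n] v \<longleftrightarrow> Q n v \<and> (\<forall>m<v. \<not> Q n m)" for n v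
  proof
    assume "eval orc (CMn s) [n] v"
    then show "Q n v \<and> (\<forall>m<v. \<not> Q n m)"
      by (rule eval_CMnE) (auto simp: s_iff split: if_splits)
  next
    assume "Q n v \<and> (\<forall>m<v. \<not> Q n m)"
    then show "eval orc (CMn s) [n] v"
      by (intro ev_mn) (auto simp: s_iff)
  qed
  then show ?thesis by blast
qed

section \<open>Words and their codes\<close>

lemma wcode_Nil [simp]: "wcode [] = 0"
  and wcode_Cons [simp]: "wcode (b # w) = 2 * wcode w + (if b then 2 else 1)"
  by (simp_all add: wcode_def)

lemma wcode_append: "wcode (u @ v) = wcode u + 2 ^ length u * wcode v"
  by (induction u) (auto simp: algebra_simps)

lemma wcode_eq_0_iff [simp]: "wcode w = 0 \<longleftrightarrow> w = []"
  by (cases w) auto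

lemma wcode_inject [simp]: "wcode u = wcode v \<longleftrightarrow> u = v"
proof (induction u arbitrary: v)
  case Nil
  show ?case by (metis wcode_Nil wcode_eq_0_iff)
next
  case (Cons b u)
  show ?case
  proof (cases v)
    case (Cons b' v')
    have "2 * wcode u + (if b then 2 else 1) = 2 * wcode v' + (if b' then 2 else 1)
      \<longleftrightarrow> b = b' \<and> wcode u = wcode v'"
      by (auto; presburger)
    with Cons Cons.IH show ?thesis by auto
  qed simp
qed

lemma ex_wcode: "\<exists>w. wcode w = n"
proof (induction n rule: less_induct)
  case (less n)
  show ?case
  proof (cases "n = 0")
    case True
    then show ?thesis using wcode_Nil by blast
  next
    case False
    then have "(n - 1) div 2 < n" by auto
    from less[OF this] obtain w where "wcode w = (n - 1) div 2" by blast
    with False have "wcode (even n # w) = n" by (auto elim!: evenE oddE)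
    then show ?thesis by blast
  qed
qed

text \<open>The binary digits of \<open>Suc (wcode w)\<close>, from the lowest upwards, are the
  letters of \<open>w\<close> followed by a final 1. Hence lengths and letters are read off from the
  successor of the code.\<close>

lemma Suc_wcode_bounds: "2 ^ length w \<le> Suc (wcode w)" "Suc (wcode w) < 2 ^ Suc (length w)"
  by (induction w) auto

lemma length_eq_iff_wcode:
  "length w = N \<longleftrightarrow> 2 ^ N \<le> Suc (wcode w) \<and> Suc (wcode w) < 2 ^ Suc N"
proof
  assume "2 ^ N \<le> Suc (wcode w) \<and> Suc (wcode w) < 2 ^ Suc N"
  with Suc_wcode_bounds[of w] have "(2::nat) ^ N < 2 ^ Suc (length w)" "(2::nat) ^ length w < 2 ^ Suc N"
    by linarith+
  then have "N < Suc (length w)" "length w < Suc N"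
    by (simp_all only: power_strict_increasing_iff one_less_numeral_iff semiring_norm)
  then show "length w = N" by simp
qed (use Suc_wcode_bounds in blast)

lemma odd_Suc_wcode_div:
  "i < length w \<Longrightarrow> odd (Suc (wcode w) div 2 ^ i) \<longleftrightarrow> w ! i"
proof (induction w arbitrary: i)
  case (Cons b w)
  have "Suc (wcode (b # w)) div 2 = Suc (wcode w)" by simp
  with Cons show ?case
    by (cases i) (simp_all add: div_mult2_eq)
qed simp

text \<open>Turns the recognition of programs with a unary header into an equation between numbers.
  Adding 2 avoids a subtraction, as \<open>c\<close> letters \<open>True\<close> have the code
  \<open>2 ^ Suc c - 2\<close>.\<close>

lemma wcode_unary_prefix:
  "wcode (replicate c True @ False # r) + 2 = 2 ^ Suc c * wcode r + 3 * 2 ^ c"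
proof -
  have "wcode (replicate c True) + 2 = 2 * 2 ^ c" by (induction c) auto
  then show ?thesis by (simp add: wcode_append algebra_simps)
qed

text \<open>The first \<open>False\<close> ends the header, so that programs of this form delimit
  \<open>c\<close> themselves.\<close>

lemma unary_prefix_inject:
  "replicate c True @ False # r = replicate d True @ False # s \<longleftrightarrow> c = d \<and> r = s"
proof (induction c arbitrary: d)
  case 0
  show ?case by (cases d) auto
next
  case (Suc c)
  then show ?case by (cases d) auto
qed

lemma length_le_wcode: "length w \<le> wcode w"
  by (induction w) auto

section \<open>Complex strings pass recursive tests\<close>

text \<open>A word \<open>w\<close> of length \<open>N c\<close> in the test set of level \<open>c\<close> has the program
  \<open>1\<^sup>c 0 r\<close>, where the word \<open>r\<close> of length \<open>N c - (2 * c + 1)\<close> encodes the rank of \<open>w\<close> in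
  the test set. This saves \<open>c\<close> bits, for every \<open>c\<close>.\<close>

lemma KC_string_passes_test:
  assumes N: "rec_fun_rel no_oracle N"
    and P: "decp no_oracle (\<lambda>p. P (pfst p) (psnd p))"
    and small: "\<And>c. card {w. length w = N c \<and> P c (wcode w)} * 2 ^ (2 * c + 1) \<le> 2 ^ N c"
    and U: "universal_prefix U" and KC: "KC_string U \<epsilon>"
  shows "\<exists>c. \<not> P c (wcode (init_seg \<epsilon> (N c)))"
proof (rule ccontr)
  assume "\<nexists>c. \<not> P c (wcode (init_seg \<epsilon> (N c)))"
  then have in_test: "P c (wcode (init_seg \<epsilon> (N c)))" for c by blast
  define T where "T c v \<longleftrightarrow> 2 ^ N c \<le> Suc v \<and> Suc v < 2 ^ Suc (N c) \<and> P c v" for c v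
  define rank where "rank c v = (\<Sum>i<v. of_bool (T c i) :: nat)" for c v
  define l where "l c = N c - (2 * c + 1)" for c
  \<comment> \<open>\<open>Q n v\<close> means that the program with code \<open>n\<close> outputs
    the word with code \<open>v\<close>. The remainder \<open>r\<close> of the program has the code
    \<open>rank c v + 2 ^ l c - 1\<close>; since the rank is below \<open>2 ^ l c\<close>, this is
    the code of a word of length \<open>l c\<close>. The bound \<open>c < n\<close> makes
    \<open>Q\<close> decidable.\<close>
  define Q where "Q n v \<longleftrightarrow> (\<exists>c<n. n + 2 = 2 ^ Suc c * (rank c v + 2 ^ l c - 1) + 3 * 2 ^ c \<and> T c v)"
    for n v
  define word where "word = inv wcode"
  have word: "wcode (word v) = v" for v
    unfolding word_def by (rule f_inv_into_f) (use ex_wcode in \<open>metis rangeI\<close>)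
  have word_wcode: "word (wcode w) = w" for w using word by (metis wcode_inject)

  have finT: "finite {v. T c v}" for c
    by (rule finite_subset[of _ "{..<2 ^ Suc (N c)}"]) (auto simp: T_def)
  have rank_card: "rank c v = card {i. i < v \<and> T c i}" for c v
    by (simp add: rank_def Collect_conj_eq lessThan_def)
  have "{v. T c v} = wcode ` {w. length w = N c \<and> P c (wcode w)}" for c
    by (auto simp: T_def length_eq_iff_wcode) (metis (mono_tags, lifting) image_eqI mem_Collect_eq word power_Suc)
  then have cardT: "card {v. T c v} = card {w. length w = N c \<and> P c (wcode w)}" for c
    by (simp add: card_image inj_on_def)
  have rank_mono: "rank c v < rank c v'" if "v < v'" "T c v" for c v v'
    unfolding rank_card using that by (intro psubset_card_mono) auto
  \<comment> \<open>A nonempty test set forces \<open>2 * c + 1 \<le> N c\<close>. The subtraction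
    in \<open>l c\<close> is then exact, and the set has at most \<open>2 ^ l c\<close>
    elements.\<close>
  have rank_less: "rank c v < 2 ^ l c" "2 * c + 1 \<le> N c" if "T c v" for c v
  proof -
    have "rank c v < card {v. T c v}"
      unfolding rank_card using that by (intro psubset_card_mono finT) auto
    moreover have le: "card {v. T c v} * 2 ^ (2 * c + 1) \<le> 2 ^ N c" using small cardT by metis
    ultimately have "1 * (2::nat) ^ (2 * c + 1) \<le> 2 ^ N c"
      by (intro order_trans[OF mult_right_mono le]) auto
    then show "2 * c + 1 \<le> N c" by (simp del: power_Suc)
    then have "(2::nat) ^ N c = 2 ^ l c * 2 ^ (2 * c + 1)"
      unfolding l_def by (metis le_add_diff_inverse2 power_add)
    with le have "card {v. T c v} \<le> 2 ^ l c" by simp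
    with \<open>rank c v < card {v. T c v}\<close> show "rank c v < 2 ^ l c" by simp
  qed
  have Q_iff: "Q (wcode p) v \<longleftrightarrow> (\<exists>c r. p = replicate c True @ False # r \<and> T c v
      \<and> Suc (wcode r) = rank c v + 2 ^ l c \<and> length r = l c)" for p v
  proof
    assume "Q (wcode p) v"
    then obtain c where c: "wcode p + 2 = 2 ^ Suc c * (rank c v + 2 ^ l c - 1) + 3 * 2 ^ c" "T c v"
      by (auto simp: Q_def)
    define r where "r = word (rank c v + 2 ^ l c - 1)"
    have "wcode p + 2 = wcode (replicate c True @ False # r) + 2"
      unfolding wcode_unary_prefix c r_def word ..
    then have "p = replicate c True @ False # r" by simp
    moreover have r: "Suc (wcode r) = rank c v + 2 ^ l c" by (simp add: r_def word)
    moreover have "length r = l c"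
      unfolding length_eq_iff_wcode r using rank_less[OF c(2)] by simp
    ultimately show "\<exists>c r. p = replicate c True @ False # r \<and> T c v
      \<and> Suc (wcode r) = rank c v + 2 ^ l c \<and> length r = l c" using c(2) by blast
  next
    assume "\<exists>c r. p = replicate c True @ False # r \<and> T c v
      \<and> Suc (wcode r) = rank c v + 2 ^ l c \<and> length r = l c"
    then obtain c r where r: "p = replicate c True @ False # r" "T c v"
      "Suc (wcode r) = rank c v + 2 ^ l c" by blast
    have "c < wcode p" using length_le_wcode[of p] r(1) by simp
    moreover have "wcode r = rank c v + 2 ^ l c - 1" using r(3) by simp
    ultimately show "Q (wcode p) v"
      using wcode_unary_prefix[of c r] r unfolding Q_def by auto
  qed
  \<comment> \<open>The program determines \<open>c\<close> and \<open>r\<close>, hence the rank,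
    and the rank is strictly increasing on the test set.\<close>
  have Q_unique: "v = v'" if Q: "Q (wcode p) v" "Q (wcode p) v'" for p v v'
  proof -
    obtain c r where "p = replicate c True @ False # r" "T c v"
      "Suc (wcode r) = rank c v + 2 ^ l c"
      using Q(1) unfolding Q_iff by blast
    moreover obtain c' r' where "p = replicate c' True @ False # r'" "T c' v'"
      "Suc (wcode r') = rank c' v' + 2 ^ l c'"
      using Q(2) unfolding Q_iff by blast
    ultimately have "T c v" "T c v'" "rank c v = rank c v'"
      using unary_prefix_inject[of c r c' r'] by auto
    then show ?thesis using rank_mono[of v v' c] rank_mono[of v' v c] by (cases v v' rule: linorder_cases) auto
  qed
  define V where "V p = (if \<exists>v. Q (wcode p) v then Some (word (THE v. Q (wcode p) v)) else None)"
    for p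
  have V_iff: "V p = Some w \<longleftrightarrow> Q (wcode p) (wcode w)" for p w
  proof (cases "\<exists>v. Q (wcode p) v")
    case True
    then obtain v where v: "Q (wcode p) v" by blast
    then have "(THE v. Q (wcode p) v) = v" using Q_unique by blast
    then have "V p = Some (word v)" using True by (simp add: V_def)
    moreover have "word v = w \<longleftrightarrow> v = wcode w" using word word_wcode by metis
    ultimately show ?thesis using v Q_unique by auto
  qed (auto simp: V_def)
  have decT: "decp no_oracle (\<lambda>p. T (f p) (g p))"
    if f: "rec_fun_rel no_oracle f" and g: "rec_fun_rel no_oracle g" for f g
    unfolding T_def
    using decp_comp[OF P rec_pair[OF f g]]
    by (intro decp_conj decp_le decp_less rec_Suc rec_power rec_const rec_comp[OF N] f g) simp
  have "decp no_oracle (\<lambda>p. Q (pfst p) (psnd p))"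
    unfolding Q_def rank_def l_def
    by (intro decp_bex rec_pfst rec_psnd rec_id decp_conj decp_eq rec_add rec_mult rec_power rec_diff
        rec_const rec_sum rec_of_bool rec_comp[OF N] decT rec_Suc)
  then obtain t where t: "\<And>n v. eval no_oracle t [n] v \<longleftrightarrow> Q n v \<and> (\<forall>m<v. \<not> Q n m)"
    using decp_search by blast
  have "eval no_oracle t [wcode p] v \<longleftrightarrow> (\<exists>y. V p = Some y \<and> v = wcode y)" for p v
  proof -
    have "(\<forall>m<v. \<not> Q (wcode p) m)" if "Q (wcode p) v"
      using that Q_unique by blast
    then show ?thesis unfolding t V_iff using word by metis
  qed
  then have "partial_rec_word V" unfolding partial_rec_word_def by blast
  moreover have "prefix_free_dom V"
    unfolding prefix_free_dom_def
  proof (intro allI impI)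
    fix p s assume "V p \<noteq> None" "V (p @ s) \<noteq> None"
    then obtain v v' where "Q (wcode p) v" "Q (wcode (p @ s)) v'"
      unfolding V_def by (auto split: if_splits)
    then obtain c r c' r' where "p = replicate c True @ False # r" "length r = l c"
      "p @ s = replicate c' True @ False # r'" "length r' = l c'"
      unfolding Q_iff by blast
    then have "replicate c True @ False # (r @ s) = replicate c' True @ False # r'" by simp
    \<comment> \<open>Equal headers give equal levels, and the level fixes the length of the
      remainder, which leaves no room for \<open>s\<close>.\<close>
    then have "c = c'" "r @ s = r'" unfolding unary_prefix_inject by auto
    with \<open>length r = l c\<close> \<open>length r' = l c'\<close> show "s = []" by auto
  qed
  ultimately obtain d where d: "\<And>p y. V p = Some y \<Longrightarrow> \<exists>q. U q = Some y \<and> length q \<le> length p + d"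
    using U unfolding universal_prefix_def prefix_algorithm_def by metis
  obtain m where m: "\<And>n. int n - int m \<le> int (Hc U (init_seg \<epsilon> n))"
    using KC unfolding KC_string_def by auto
  \<comment> \<open>The program for \<open>w\<close> on \<open>V\<close> has length
    \<open>N c - c\<close>, so \<open>U\<close> has one of length at most
    \<open>N c - c + d\<close>. Complexity demands at least \<open>N c - m\<close>, which fails as
    soon as \<open>c > m + d\<close>.\<close>
  define c where "c = m + d + 1"
  define w where "w = init_seg \<epsilon> (N c)"
  have "length w = N c" by (simp add: w_def init_seg_def)
  then have T: "T c (wcode w)"
    using in_test[of c] unfolding T_def w_def length_eq_iff_wcode by simp
  define r where "r = word (rank c (wcode w) + 2 ^ l c - 1)"
  have r: "Suc (wcode r) = rank c (wcode w) + 2 ^ l c" by (simp add: r_def word)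
  have len_r: "length r = l c"
    unfolding length_eq_iff_wcode r using rank_less[OF T] by simp
  have "V (replicate c True @ False # r) = Some w"
    unfolding V_iff Q_iff using T r len_r by blast
  then obtain q where q: "U q = Some w" "length q \<le> length (replicate c True @ False # r) + d"
    using d by blast
  have "Hc U w \<le> length q" unfolding Hc_def using q(1) by (intro Least_le) blast
  moreover have "int (N c) - int m \<le> int (Hc U w)" unfolding w_def by (rule m)
  moreover have "length q + c \<le> N c + d" using q(2) len_r rank_less(2)[OF T] by (simp add: l_def)
  ultimately show False unfolding c_def by linarith
qed

section \<open>Counting sets that miss a point of each of many disjoint sets\<close>

text \<open>Induction on \<open>J\<close>: a set \<open>S\<close> splits into its part in
  \<open>D k\<close>, which may be any proper subset of \<open>D k\<close>, and its part outside, to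
  which the induction hypothesis applies. Each step costs a factor \<open>1 - 2 ^ (- t)\<close>;
  denominators are cleared to stay in the natural numbers.\<close>

lemma card_avoiding_disjoint:
  assumes "finite A" "finite J" "\<And>j. j \<in> J \<Longrightarrow> D j \<subseteq> A" "\<And>j. j \<in> J \<Longrightarrow> card (D j) \<le> t"
    and "\<And>i j. i \<in> J \<Longrightarrow> j \<in> J \<Longrightarrow> i \<noteq> j \<Longrightarrow> D i \<inter> D j = {}"
  shows "card {S. S \<subseteq> A \<and> (\<forall>j\<in>J. \<not> D j \<subseteq> S)} * (2 ^ t) ^ card J \<le> 2 ^ card A * (2 ^ t - 1) ^ card J"
  using assms(2,1,3-)
proof (induction J arbitrary: A rule: finite_induct)
  case empty
  then show ?case by (simp add: Pow_def[symmetric] card_Pow)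
next
  case (insert k J)
  define A' where "A' = A - D k"
  have Dk: "D k \<subseteq> A" "finite (D k)"
    using insert.prems finite_subset[of "D k" A] by auto
  have DA': "D j \<subseteq> A'" if "j \<in> J" for j
    using insert.prems(2)[of j] insert.prems(4)[of k j] that insert.hyps(2) unfolding A'_def by auto
  let ?F = "{S. S \<subseteq> A \<and> (\<forall>j\<in>insert k J. \<not> D j \<subseteq> S)}"
  let ?F' = "{S. S \<subseteq> A' \<and> (\<forall>j\<in>J. \<not> D j \<subseteq> S)}"
  have "finite A'" using insert.prems(1) by (simp add: A'_def)
  have "finite ?F'" by (rule finite_subset[of _ "Pow A'"]) (use \<open>finite A'\<close> in auto)
  have "?F \<subseteq> (\<lambda>(S, S'). S \<union> S') ` ((Pow (D k) - {D k}) \<times> ?F')"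
  proof
    fix S assume S: "S \<in> ?F"
    have "S = (S \<inter> D k) \<union> (S \<inter> A')" using S by (auto simp: A'_def)
    moreover have "S \<inter> A' \<in> ?F'" using S DA' by blast
    moreover have "S \<inter> D k \<in> Pow (D k) - {D k}" using S by auto
    ultimately show "S \<in> (\<lambda>(S, S'). S \<union> S') ` ((Pow (D k) - {D k}) \<times> ?F')"
      by (intro image_eqI[of _ _ "(S \<inter> D k, S \<inter> A')"]) auto
  qed
  then have "card ?F \<le> card ((Pow (D k) - {D k}) \<times> ?F')"
    using \<open>finite ?F'\<close> Dk by (intro surj_card_le) auto
  also have "\<dots> = (2 ^ card (D k) - 1) * card ?F'"
    using Dk by (simp add: card_cartesian_product card_Pow)
  finally have F: "card ?F \<le> (2 ^ card (D k) - 1) * card ?F'" .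
  have IH: "card ?F' * (2 ^ t) ^ card J \<le> 2 ^ card A' * (2 ^ t - 1) ^ card J"
    by (rule insert.IH) (use \<open>finite A'\<close> DA' insert.prems in auto)
  have cardA: "card A = card (D k) + card A'"
    unfolding A'_def using Dk insert.prems(1)
    by (simp add: card_Diff_subset card_mono)
  \<comment> \<open>The fraction \<open>1 - 2 ^ (- d)\<close> increases with \<open>d\<close>, so
    the value at \<open>t\<close> also bounds that for smaller sets.\<close>
  have q: "(2 ^ card (D k) - 1) * 2 ^ t \<le> 2 ^ card (D k) * (2 ^ t - 1 :: nat)"
    using insert.prems(3)[of k] 
    by (auto simp: diff_mult_distrib diff_mult_distrib2 intro!: diff_le_mono2 power_increasing)
  have "card ?F * (2 ^ t) ^ card (insert k J)
      \<le> (2 ^ card (D k) - 1) * card ?F' * (2 ^ t * (2 ^ t) ^ card J)"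
    using F insert.hyps by (simp add: mult_right_mono)
  also have "\<dots> = ((2 ^ card (D k) - 1) * 2 ^ t) * (card ?F' * (2 ^ t) ^ card J)"
    by (simp only: ac_simps)
  also have "\<dots> \<le> (2 ^ card (D k) * (2 ^ t - 1)) * (2 ^ card A' * (2 ^ t - 1) ^ card J)"
    by (rule mult_mono[OF q IH]) auto
  also have "\<dots> = 2 ^ card A * (2 ^ t - 1) ^ card (insert k J)"
    using insert.hyps cardA by (simp add: power_add)
  finally show ?case .
qed

text \<open>The powers of \<open>(q - 1) / q\<close> tend to 0. Comparing with
  \<open>1 / (M + 1)\<close> also covers \<open>M = 0\<close>.\<close>

lemma ex_power_ratio_le:
  assumes "(0::nat) < q"
  shows "\<exists>s. (q - 1) ^ s * M \<le> q ^ s"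
proof -
  have less_1: "(real q - 1) / real q < 1" using assms by simp
  from real_arch_pow_inv[OF _ less_1, of "1 / (real M + 1)"]
  obtain s where "((real q - 1) / real q) ^ s < 1 / (real M + 1)" by auto
  then have "(real q - 1) ^ s * (real M + 1) < real q ^ s"
    using assms by (simp add: power_divide field_simps)
  moreover have "(real q - 1) ^ s * real M \<le> (real q - 1) ^ s * (real M + 1)"
    using assms by (intro mult_left_mono) auto
  ultimately have "real ((q - 1) ^ s * M) \<le> real (q ^ s)"
    using assms by (simp add: of_nat_diff)
  then show ?thesis using of_nat_le_iff by blast
qed

section \<open>Types of tuples in a homogeneous structure\<close>

text \<open>Equality of quantifier-free types of two \<open>n\<close>-tuples, possibly with
  repetitions. In a homogeneous structure it amounts to being conjugate under an
  automorphism.\<close>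

definition same_type :: "nat list \<Rightarrow> struc \<Rightarrow> nat \<Rightarrow> (nat \<Rightarrow> nat) \<Rightarrow> (nat \<Rightarrow> nat) \<Rightarrow> bool" where
  "same_type ar X n f g \<longleftrightarrow> (\<forall>a<n. \<forall>b<n. f a = f b \<longleftrightarrow> g a = g b) \<and>
     (\<forall>i<length ar. \<forall>xs. length xs = ar ! i \<longrightarrow> set xs \<subseteq> {..<n} \<longrightarrow>
        (snd X i (map f xs) \<longleftrightarrow> snd X i (map g xs)))"

lemma same_type_refl: "same_type ar X n f f"
  by (simp add: same_type_def)

lemma same_type_sym: "same_type ar X n f g \<Longrightarrow> same_type ar X n g f"
  by (simp add: same_type_def)

lemma same_type_trans:
  "same_type ar X n f g \<Longrightarrow> same_type ar X n g h \<Longrightarrow> same_type ar X n f h"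
  by (simp add: same_type_def)

lemma same_type_comp:
  assumes "same_type ar X n f g" "\<And>a. a < m \<Longrightarrow> w a < n"
  shows "same_type ar X m (\<lambda>a. f (w a)) (\<lambda>a. g (w a))"
proof -
  have "snd X i (map (\<lambda>a. f (w a)) xs) \<longleftrightarrow> snd X i (map (\<lambda>a. g (w a)) xs)"
    if "i < length ar" "length xs = ar ! i" "set xs \<subseteq> {..<m}" for i xs
    using assms that unfolding same_type_def
    by (auto simp: comp_def subset_eq dest!: spec[of _ i] spec[of _ "map w xs"])
  then show ?thesis using assms by (auto simp: same_type_def)
qed

lemma same_type_cong:
  assumes "\<And>a. a < n \<Longrightarrow> f a = f' a" "\<And>a. a < n \<Longrightarrow> g a = g' a"
  shows "same_type ar X n f g \<longleftrightarrow> same_type ar X n f' g'"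
proof -
  have "map f xs = map f' xs" "map g xs = map g' xs" if "set xs \<subseteq> {..<n}" for xs
    using assms that by auto
  then have "snd X i (map f xs) = snd X i (map f' xs)" "snd X i (map g xs) = snd X i (map g' xs)"
    if "set xs \<subseteq> {..<n}" for i xs
    using that by metis+
  with assms show ?thesis by (simp add: same_type_def)
qed

lemma same_type_inj_on: "same_type ar X n f g \<Longrightarrow> inj_on f {..<n} \<Longrightarrow> inj_on g {..<n}"
  by (auto simp: same_type_def inj_on_def)

text \<open>One reference embedding \<open>g\<close> replaces the structure \<open>b\<close>, so
  that later arguments concern only tuples in \<open>X\<close>. Injectivity of \<open>f\<close> is
  part of the equality pattern shared with the injective \<open>g\<close>.\<close>

lemma emb_restr_iff_same_type:
  assumes X: "fst X = UNIV" and b: "fst b = {0..<n}" and g: "emb ar b X g"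
  shows "emb ar b (restr X Y) f \<longleftrightarrow> f ` {..<n} \<subseteq> Y \<and> same_type ar X n g f"
proof -
  have g': "\<forall>i<length ar. \<forall>xs. length xs = ar ! i \<longrightarrow> set xs \<subseteq> {..<n} \<longrightarrow>
      (snd b i xs \<longleftrightarrow> snd X i (map g xs))" "inj_on g {..<n}"
    using g b by (auto simp: emb_def atLeast0LessThan)
  have "set (map f xs) \<subseteq> Y" if "set xs \<subseteq> {..<n}" "f ` {..<n} \<subseteq> Y" for xs
    using that by auto
  then have "emb ar b (restr X Y) f \<longleftrightarrow> f ` {..<n} \<subseteq> Y \<and> inj_on f {..<n} \<and>
     (\<forall>i<length ar. \<forall>xs. length xs = ar ! i \<longrightarrow> set xs \<subseteq> {..<n} \<longrightarrow>
        (snd b i xs \<longleftrightarrow> snd X i (map f xs)))"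
    using b by (auto simp: emb_def restr_def atLeast0LessThan)
  moreover have "inj_on f {..<n} \<longleftrightarrow> (\<forall>a<n. \<forall>b<n. g a = g b \<longleftrightarrow> f a = f b)"
    using g'(2) by (auto simp: inj_on_def)
  ultimately show ?thesis using g' by (simp add: same_type_def)
qed

lemma emb_comp: "emb ar A B f \<Longrightarrow> emb ar B C g \<Longrightarrow> emb ar A C (g \<circ> f)"
proof -
  assume f: "emb ar A B f" and g: "emb ar B C g"
  have "snd A i xs \<longleftrightarrow> snd C i (map (g \<circ> f) xs)"
    if "i < length ar" "length xs = ar ! i" "set xs \<subseteq> fst A" for i xs
  proof -
    have "set (map f xs) \<subseteq> fst B" using f that by (auto simp: emb_def)
    then have "snd B i (map f xs) \<longleftrightarrow> snd C i (map g (map f xs))"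
      using g that unfolding emb_def by (metis length_map)
    then show ?thesis using f that by (simp add: emb_def)
  qed
  moreover have "inj_on (g \<circ> f) (fst A)"
    using f g by (auto simp: emb_def intro: comp_inj_on inj_on_subset)
  moreover have "(g \<circ> f) ` fst A \<subseteq> fst C"
    using f g by (fastforce simp: emb_def)
  ultimately show ?thesis by (simp add: emb_def)
qed

lemma restr_UNIV: "fst X = UNIV \<Longrightarrow> restr X UNIV = X"
  by (simp add: restr_def prod_eq_iff)

text \<open>The common equality pattern makes the map from \<open>f a\<close> to \<open>g a\<close>
  a well-defined bijection of the ranges, the common relations make it an isomorphism, and
  homogeneity extends it.\<close>

lemma same_type_extends:
  assumes X: "fst X = UNIV" and hom: "homogeneous ar X" and fg: "same_type ar X n f g"
  shows "\<exists>h. inj h \<and> emb ar X X h \<and> (\<forall>a<n. h (f a) = g a)"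
proof -
  define w where "w y = (SOME a. a < n \<and> f a = y)" for y
  have w: "w (f a) < n \<and> f (w (f a)) = f a" if "a < n" for a
    unfolding w_def by (rule someI[of _ a]) (use that in simp)
  define k where "k y = g (w y)" for y
  have k: "k (f a) = g a" if "a < n" for a
    unfolding k_def using w[OF that] fg that by (auto simp: same_type_def)
  have img: "k ` f ` {..<n} = g ` {..<n}" using k by (force simp: image_iff)
  have "emb ar (restr X (f ` {..<n})) (restr X (g ` {..<n})) k"
    unfolding emb_def
  proof (intro conjI allI impI)
    show "k ` fst (restr X (f ` {..<n})) \<subseteq> fst (restr X (g ` {..<n}))"
      using img by (simp add: restr_def)
    show "inj_on k (fst (restr X (f ` {..<n})))"
      using fg k by (auto simp: restr_def inj_on_def same_type_def)
    fix i xs assume i: "i < length ar" "length xs = ar ! i" "set xs \<subseteq> fst (restr X (f ` {..<n}))"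
    then have xs: "set xs \<subseteq> f ` {..<n}" by (simp add: restr_def)
    then have "map f (map w xs) = xs" using w by (auto intro!: map_idI)
    moreover have "map k xs = map g (map w xs)" by (simp add: k_def)
    moreover have "set (map w xs) \<subseteq> {..<n}" using xs w by auto
    ultimately have "snd X i xs \<longleftrightarrow> snd X i (map k xs)"
      using fg i unfolding same_type_def by (metis length_map)
    moreover have "set (map k xs) \<subseteq> g ` {..<n}" using xs img by (metis image_mono image_set)
    ultimately show "snd (restr X (f ` {..<n})) i xs \<longleftrightarrow> snd (restr X (g ` {..<n})) i (map k xs)"
      using xs by (simp add: restr_def)
  qed
  with hom img obtain h where "bij_betw h (fst X) (fst X)" "emb ar X X h"
    "\<forall>y\<in>f ` {..<n}. h y = k y"
    unfolding homogeneous_def X by (metis finite_imageI finite_lessThan subset_UNIV)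
  then show ?thesis using k X by (auto simp: bij_betw_def)
qed

lemma same_type_emb:
  assumes "emb ar X X h" "fst X = UNIV"
  shows "same_type ar X n f (\<lambda>a. h (f a))"
proof -
  have "snd X i (map f xs) \<longleftrightarrow> snd X i (map (\<lambda>a. h (f a)) xs)"
    if "i < length ar" "length xs = ar ! i" for i xs
  proof -
    have "snd X i (map f xs) \<longleftrightarrow> snd X i (map h (map f xs))"
      using assms that unfolding emb_def by (metis length_map subset_UNIV)
    then show ?thesis by (simp add: comp_def)
  qed
  moreover have "inj h" using assms by (simp add: emb_def)
  ultimately show ?thesis by (auto simp: same_type_def inj_eq)
qed

section \<open>From density of the age to infinitely many realizations of a type\<close>

definition pullback_struc :: "nat list \<Rightarrow> struc \<Rightarrow> nat \<Rightarrow> (nat \<Rightarrow> nat) \<Rightarrow> struc" where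
  "pullback_struc ar X n f = ({0..<n}, \<lambda>i xs. i < length ar \<and> length xs = ar ! i \<and>
     set xs \<subseteq> {0..<n} \<and> snd X i (map f xs))"

lemma emb_pullback_struc:
  "fst X = UNIV \<Longrightarrow> inj_on f {..<n} \<Longrightarrow> emb ar (pullback_struc ar X n f) X f"
  by (simp add: emb_def pullback_struc_def atLeast0LessThan)

lemma pullback_struc_in_Age:
  "fst X = UNIV \<Longrightarrow> inj_on f {..<n} \<Longrightarrow> pullback_struc ar X n f \<in> Age ar X"
  using emb_pullback_struc[of X f n ar]
  by (auto simp: Age_def is_struc_def pullback_struc_def)

text \<open>Density, applied to the inclusion of the points indexed by \<open>J\<close> into the
  whole tuple, gives two copies of the tuple that meet only in those points. They are embedded into
  \<open>X\<close> and moved by homogeneity so that the first copy becomes \<open>z\<close>; the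
  second one is \<open>z'\<close>.\<close>

lemma ex_free_realization:
  assumes X: "fst X = UNIV" and hom: "homogeneous ar X" and dense: "age_dense ar X"
    and z: "inj_on z {..<n}" and J: "J \<subseteq> {..<n}" "j < n" "j \<notin> J"
  shows "\<exists>z'. same_type ar X n z z' \<and> (\<forall>a\<in>J. z' a = z a) \<and> z' j \<notin> z ` {..<n}"
proof -
  have "finite J" using J(1) finite_subset by blast
  \<comment> \<open>\<open>Age\<close> only contains structures on initial segments, so
    \<open>J\<close> is renumbered by \<open>jl\<close>.\<close>
  then obtain jl where jl: "bij_betw jl {0..<card J} J" using ex_bij_betw_nat_finite by blast
  then have jl_img: "jl ` {0..<card J} = J" and jl_inj: "inj_on jl {0..<card J}"
    by (auto simp: bij_betw_def)
  let ?A = "pullback_struc ar X (card J) (z \<circ> jl)" and ?B = "pullback_struc ar X n z"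
  have jl_less: "jl a < n" if "a < card J" for a using that jl_img J(1) by auto
  have "inj_on (z \<circ> jl) {0..<card J}"
    using jl_inj jl_img J(1) z by (auto intro!: comp_inj_on intro: inj_on_subset)
  then have "?A \<in> Age ar X" by (intro pullback_struc_in_Age X) (simp add: atLeast0LessThan)
  moreover have "?B \<in> Age ar X" by (rule pullback_struc_in_Age[OF X z])
  moreover have "emb ar ?A ?B jl"
    using jl_less jl_inj by (auto simp: emb_def pullback_struc_def subset_eq)
  ultimately obtain C f1 f2 where C: "C \<in> Age ar X" "emb ar ?B C f1" "emb ar ?B C f2"
    "\<forall>a\<in>fst ?A. f1 (jl a) = f2 (jl a)"
    "f1 ` fst ?B \<inter> f2 ` fst ?B = f1 ` jl ` fst ?A" "f1 ` jl ` fst ?A = f2 ` jl ` fst ?A"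
    using dense unfolding age_dense_def by meson
  obtain c where c: "emb ar C X c" using C(1) by (auto simp: Age_def)
  have type: "same_type ar X n z u" if "emb ar ?B X u" for u
    using emb_restr_iff_same_type[OF X _ emb_pullback_struc[OF X z], where Y = UNIV and f = u] that X
    by (simp add: restr_UNIV) (simp add: pullback_struc_def)
  note type1 = type[OF emb_comp[OF C(2) c]] and type2 = type[OF emb_comp[OF C(3) c]]
  from same_type_extends[OF X hom same_type_sym[OF type1]]
  obtain h where h: "inj h" "emb ar X X h" "\<And>a. a < n \<Longrightarrow> h (c (f1 a)) = z a" by auto
  have domA: "jl ` fst ?A = J" using jl_img by (simp add: pullback_struc_def)
  have domB: "fst ?B = {..<n}" by (simp add: pullback_struc_def atLeast0LessThan)
  have f12: "f1 a = f2 a" if "a \<in> J" for a 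
  proof -
    obtain a' where "a' \<in> fst ?A" "a = jl a'" using \<open>a \<in> J\<close> domA by blast
    with C(4) show ?thesis by blast
  qed
  have "h (c (f2 j)) \<noteq> z a" if "a < n" for a
  proof
    assume "h (c (f2 j)) = z a"
    then have "c (f2 j) = c (f1 a)" using h(1,3) that by (metis injD)
    moreover have "f2 j \<in> fst C" "f1 a \<in> fst C"
      using C(2,3) that J(2) domB by (auto simp: emb_def)
    ultimately have "f2 j = f1 a" using c by (auto simp: emb_def inj_on_def)
    then have "f2 j \<in> f2 ` J" using C(5,6) that J(2) unfolding domA domB by blast
    moreover have "inj_on f2 {..<n}" using C(3) domB by (simp add: emb_def)
    ultimately have "j \<in> J" using J(1,2) by (simp add: inj_on_image_mem_iff)
    with J(3) show False ..
  qed
  moreover have "same_type ar X n z (\<lambda>a. h (c (f2 a)))"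
    using same_type_trans[OF type2 same_type_emb[OF h(2) X]] by (simp add: comp_def)
  ultimately show ?thesis using h(3) f12 J(1)
    by (intro exI[of _ "\<lambda>a. h (c (f2 a))"]) (auto; metis lessThan_iff subsetD)
qed

text \<open>If there were finitely many realizations \<open>x\<close>, they could be listed together
  with \<open>y\<close> in one tuple \<open>z\<close>. A free realization of \<open>z\<close> that
  fixes \<open>y\<close> moves one of them outside the list, yet it still realizes the type.\<close>

lemma infinite_realizations:
  assumes X: "fst X = UNIV" and hom: "homogeneous ar X" and dense: "age_dense ar X"
    and ry: "same_type ar X k r y" and v: "\<And>a. a < k \<Longrightarrow> r a \<noteq> v"
  shows "infinite {x. same_type ar X (Suc k) (case_nat v r) (case_nat x y)}" (is "infinite ?C")
proof
  assume fin: "finite ?C"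
  obtain h where h: "inj h" "emb ar X X h" "\<And>a. a < k \<Longrightarrow> h (r a) = y a"
    using same_type_extends[OF X hom ry] by blast
  have "same_type ar X (Suc k) (case_nat v r) (\<lambda>a. h (case_nat v r a))"
    by (rule same_type_emb[OF h(2) X])
  moreover have "h (case_nat v r a) = case_nat (h v) y a" if "a < Suc k" for a
    using h(3) that by (cases a) auto
  ultimately have type0: "same_type ar X (Suc k) (case_nat v r) (case_nat (h v) y)"
    using same_type_cong[of "Suc k" "case_nat v r" "case_nat v r"
        "\<lambda>a. h (case_nat v r a)" "case_nat (h v) y"] by simp
  have new: "h v \<notin> y ` {..<k}"
    using h v by (auto simp: image_iff) (metis injD)
  \<comment> \<open>All realizations and all entries of \<open>y\<close>; \<open>J\<close> below
    collects the positions of the entries of \<open>y\<close>, which stay fixed.\<close>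
  let ?Z = "?C \<union> y ` {..<k}"
  have "finite ?Z" using fin by simp
  then obtain z :: "nat \<Rightarrow> nat" and n where z: "bij_betw z {..<n} ?Z"
    using ex_bij_betw_nat_finite[of ?Z] unfolding atLeast0LessThan by blast
  then have z_inj: "inj_on z {..<n}" and z_img: "z ` {..<n} = ?Z" by (auto simp: bij_betw_def)
  have "h v \<in> z ` {..<n}" using type0 z_img by simp
  then obtain j where j: "j < n" "z j = h v" by auto
  define J where "J = {a. a < n \<and> z a \<in> y ` {..<k}}"
  have "J \<subseteq> {..<n}" "j \<notin> J" using j new by (auto simp: J_def)
  then obtain z' where z': "same_type ar X n z z'" "\<And>a. a \<in> J \<Longrightarrow> z' a = z a" "z' j \<notin> ?Z"
    using ex_free_realization[OF X hom dense z_inj] j z_img by metis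
  \<comment> \<open>\<open>w\<close> locates the entries of the tuple \<open>(h v, y)\<close> in
    \<open>z\<close>; reindexing along \<open>w\<close> transfers the type of \<open>z'\<close> to
    \<open>(z' j, y)\<close>.\<close>
  have "\<exists>w. a < Suc k \<longrightarrow> w < n \<and> z w = case_nat (h v) y a \<and> z' w = case_nat (z' j) y a" for a
  proof (cases a)
    case 0
    then show ?thesis using j by auto
  next
    case (Suc a')
    show ?thesis
    proof (cases "a' < k")
      case True
      then have "y a' \<in> z ` {..<n}" using z_img by auto
      then obtain w where w: "w < n" "z w = y a'" by auto
      then have "w \<in> J" using True by (auto simp: J_def)
      with w z'(2) Suc show ?thesis by auto
    qed (simp add: Suc)
  qed
  then obtain w where w: "\<And>a. a < Suc k \<Longrightarrow>
      w a < n \<and> z (w a) = case_nat (h v) y a \<and> z' (w a) = case_nat (z' j) y a"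
    by metis
  have "same_type ar X (Suc k) (\<lambda>a. z (w a)) (\<lambda>a. z' (w a))"
    using same_type_comp[OF z'(1)] w by blast
  then have "same_type ar X (Suc k) (case_nat (h v) y) (case_nat (z' j) y)"
    using w same_type_cong[of "Suc k" "\<lambda>a. z (w a)" "case_nat (h v) y"
        "\<lambda>a. z' (w a)" "case_nat (z' j) y"] by simp
  from same_type_trans[OF type0 this] have "z' j \<in> ?C" by simp
  with z'(3) show False by simp
qed

section \<open>Deciding types\<close>

text \<open>A number below \<open>K ^ a\<close> stands for an \<open>a\<close>-tuple over
  \<open>{..<K}\<close>, which turns quantifiers over tuples into bounded ones over numbers.\<close>

definition digit :: "nat \<Rightarrow> nat \<Rightarrow> nat \<Rightarrow> nat" where
  "digit K j q = q div K ^ j mod K"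

lemma digit_less: "0 < K \<Longrightarrow> digit K j q < K"
  by (simp add: digit_def)

lemma ex_digits:
  "set xs \<subseteq> {..<K} \<Longrightarrow> \<exists>q<K ^ length xs. \<forall>j<length xs. digit K j q = xs ! j"
proof (induction xs)
  case (Cons x xs)
  then obtain q where q: "q < K ^ length xs" "\<forall>j<length xs. digit K j q = xs ! j" by auto
  have x: "x < K" using Cons.prems by simp
  have "x + K * q < K * Suc q" using x by simp
  also have "\<dots> \<le> K * K ^ length xs" using q(1) by (intro mult_le_mono) auto
  finally have "x + K * q < K ^ length (x # xs)" by simp
  moreover have "digit K j (x + K * q) = (x # xs) ! j" if "j < length (x # xs)" for j
    using that q(2) x by (cases j) (auto simp: digit_def div_mult2_eq)
  ultimately show ?case by blast
qed simp

lemma all_tuples_iff_all_digits: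
  "(\<forall>xs. length xs = a \<longrightarrow> set xs \<subseteq> {..<K} \<longrightarrow> \<Phi> xs) \<longleftrightarrow>
   (\<forall>q<K ^ a. \<Phi> (map (\<lambda>j. digit K j q) [0..<a]))" (is "?L \<longleftrightarrow> ?R")
proof
  assume ?L
  show ?R
  proof (intro allI impI)
    fix q assume "q < K ^ a"
    then have "0 < K" if "0 < a" using that by (cases "K = 0") (auto simp: power_0_left)
    then have "set (map (\<lambda>j. digit K j q) [0..<a]) \<subseteq> {..<K}" by (auto simp: digit_less)
    with \<open>?L\<close> show "\<Phi> (map (\<lambda>j. digit K j q) [0..<a])" by simp
  qed
next
  assume ?R
  show ?L
  proof (intro allI impI)
    fix xs assume xs: "length xs = a" "set xs \<subseteq> {..<K}"
    then obtain q where "q < K ^ a" "\<forall>j<a. digit K j q = xs ! j" using ex_digits[of xs K] by auto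
    moreover from this have "xs = map (\<lambda>j. digit K j q) [0..<a]"
      using xs by (intro nth_equalityI) auto
    ultimately show "\<Phi> xs" using \<open>?R\<close> by metis
  qed
qed

lemma rec_app2:
  "rec_fun_rel orc (\<lambda>p. f (pfst p) (psnd p)) \<Longrightarrow> rec_fun_rel orc a \<Longrightarrow> rec_fun_rel orc c \<Longrightarrow>
   rec_fun_rel orc (\<lambda>n. f (a n) (c n))"
  using rec_comp[of orc "\<lambda>p. f (pfst p) (psnd p)" "\<lambda>n. pair (a n) (c n)"] by (simp add: rec_pair)

lemma decp_app2:
  "decp orc (\<lambda>p. P (pfst p) (psnd p)) \<Longrightarrow> rec_fun_rel orc a \<Longrightarrow> rec_fun_rel orc c \<Longrightarrow>
   decp orc (\<lambda>n. P (a n) (c n))"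
  using decp_comp[of orc "\<lambda>p. P (pfst p) (psnd p)" "\<lambda>n. pair (a n) (c n)"] by (simp add: rec_pair)

lemma rec_digit:
  "rec_fun_rel orc f \<Longrightarrow> rec_fun_rel orc g \<Longrightarrow> rec_fun_rel orc h \<Longrightarrow>
   rec_fun_rel orc (\<lambda>n. digit (f n) (g n) (h n))"
  unfolding digit_def by (intro rec_mod rec_div rec_power)

text \<open>For the quantifier over relation symbols: each has its own decision program, and a fixed
  finite conjunction requires no uniformity in \<open>i\<close>.\<close>

lemma decp_all_less_const:
  "(\<And>i. i < m \<Longrightarrow> decp orc (\<lambda>n. P n i)) \<Longrightarrow> decp orc (\<lambda>n. \<forall>i<(m::nat). P n i)"
proof (induction m)
  case 0
  show ?case by (simp add: decp_const)
next
  case (Suc m)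
  then show ?case unfolding All_less_Suc by (intro decp_conj) auto
qed

lemma decp_same_type:
  assumes X: "recursive_struc ar X" and K: "rec_fun_rel orc K"
    and f: "rec_fun_rel orc (\<lambda>p. f (pfst p) (psnd p))"
    and g: "rec_fun_rel orc (\<lambda>p. g (pfst p) (psnd p))"
  shows "decp orc (\<lambda>n. same_type ar X (K n) (f n) (g n))"
proof -
  have rel: "decp orc (\<lambda>p. snd X i (map (\<lambda>j. u (pfst p) (digit (K (pfst p)) j (psnd p))) [0..<ar ! i]))"
    if i: "i < length ar" and u: "rec_fun_rel orc (\<lambda>p. u (pfst p) (psnd p))" for i u
  proof -
    have P: "rec_rel (ar ! i) (snd X i)" using X i by (simp add: recursive_struc_def)
    show ?thesis
      by (rule decp_rec_rel[OF P])
        (intro rec_app2[OF u] rec_digit rec_comp[OF K] rec_pfst rec_psnd rec_id)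
  qed
  show ?thesis
    unfolding same_type_def all_tuples_iff_all_digits map_map comp_def
    by (intro decp_conj decp_ball K decp_iff decp_eq rec_comp[OF K] rec_app2[OF f] rec_app2[OF g]
        rec_pfst rec_psnd rec_id decp_all_less_const rec_power rec_const rel f g)
qed

text \<open>Nested pairs: every number codes an infinite sequence, and \<open>pair x s\<close> puts
  \<open>x\<close> in front of it, so the newest entry has index 0.\<close>

definition code_nth :: "nat \<Rightarrow> nat \<Rightarrow> nat" where
  "code_nth s j = pfst ((psnd ^^ j) s)"

lemma code_nth_pair: "code_nth (pair x s) = case_nat x (code_nth s)"
  by (rule ext) (auto simp: code_nth_def funpow_swap1 simp del: funpow.simps(2)
      simp: funpow_Suc_right split: nat.split)

lemma ex_code_nth: "\<exists>s. \<forall>j<n. code_nth s j = f j"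
proof (induction n arbitrary: f)
  case (Suc n)
  from Suc[of "\<lambda>j. f (Suc j)"] obtain s where "\<forall>j<n. code_nth s j = f (Suc j)" by blast
  then show ?case
    by (intro exI[of _ "pair (f 0) s"]) (auto simp: code_nth_pair split: nat.split)
qed simp

lemma rec_code_nth:
  assumes "rec_fun_rel orc f" "rec_fun_rel orc g"
  shows "rec_fun_rel orc (\<lambda>n. code_nth (f n) (g n))"
proof -
  have "rec_nat s (\<lambda>i v. psnd v) j = (psnd ^^ j) s" for s j by (induction j) auto
  moreover have "rec_fun_rel orc (\<lambda>n. pfst (rec_nat (f n) (\<lambda>i v. psnd v) (g n)))"
    by (intro rec_pfst rec_rec_nat rec_psnd rec_id assms)
  ultimately show ?thesis by (simp add: code_nth_def)
qed

lemma mem_iff_odd_fset_code: "finite S \<Longrightarrow> x \<in> S \<longleftrightarrow> odd (fset_code S div 2 ^ x)"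
  using set_encode_inverse[of S]
  by (auto simp: fset_code_def set_encode_def set_decode_def)

text \<open>Makes the size of a decidable set of words computable, as a bounded sum over
  codes.\<close>

lemma card_words_eq_sum:
  "card {w. length w = N \<and> P (wcode w)} =
     (\<Sum>v<2 ^ Suc N. of_bool (2 ^ N \<le> Suc v \<and> Suc v < 2 ^ Suc N \<and> P v))"
proof -
  have "wcode ` {w. length w = N \<and> P (wcode w)} =
      {v. v < 2 ^ Suc N \<and> 2 ^ N \<le> Suc v \<and> Suc v < 2 ^ Suc N \<and> P v}"
  proof (intro equalityI subsetI)
    fix v assume v: "v \<in> {v. v < 2 ^ Suc N \<and> 2 ^ N \<le> Suc v \<and> Suc v < 2 ^ Suc N \<and> P v}"
    obtain w where "v = wcode w" using ex_wcode by metis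
    with v show "v \<in> wcode ` {w. length w = N \<and> P (wcode w)}"
      by (auto simp: length_eq_iff_wcode)
  qed (auto simp: length_eq_iff_wcode)
  moreover have "card (wcode ` {w. length w = N \<and> P (wcode w)}) = card {w. length w = N \<and> P (wcode w)}"
    by (rule card_image) (simp add: inj_on_def)
  ultimately show ?thesis by (simp add: Collect_conj_eq lessThan_def del: power_Suc)
qed

section \<open>Extending a finite partial embedding within the given colour\<close>

locale enumerated_copies =
  fixes ar :: "nat list" and X b :: struc and e :: "nat \<Rightarrow> nat set" and n :: nat
    and g :: "nat \<Rightarrow> nat"
  assumes rec_X: "recursive_struc ar X" and hom: "homogeneous ar X" and dense: "age_dense ar X"
    and dom_b: "fst b = {0..<n}" and emb_g: "emb ar b X g"
    and enum: "rec_enum_norep e (copies ar X UNIV b)"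
begin

lemma dom_X: "fst X = UNIV"
  using rec_X by (simp add: recursive_struc_def)

lemma copies_iff:
  "S \<in> copies ar X Y b \<longleftrightarrow> (\<exists>z. S = z ` {..<n} \<and> z ` {..<n} \<subseteq> Y \<and> same_type ar X n g z)"
  unfolding copies_def emb_restr_iff_same_type[OF dom_X dom_b emb_g]
  by (auto simp: dom_b atLeast0LessThan)

lemma inj_e: "inj e" and range_e: "range e = copies ar X UNIV b" and finite_e: "finite (e i)"
  using enum by (auto simp: rec_enum_norep_def bij_betw_def)

lemma ex_type_e: "\<exists>z. e i = z ` {..<n} \<and> same_type ar X n g z"
  using range_e copies_iff[of "e i" UNIV] by auto

lemma ex_index: "same_type ar X n g z \<Longrightarrow> \<exists>i. e i = z ` {..<n}"
  using range_e copies_iff[of "z ` {..<n}" UNIV] by (metis rangeE subset_UNIV)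

lemma card_e: "card (e i) = n"
proof -
  obtain z where z: "e i = z ` {..<n}" "same_type ar X n g z" using ex_type_e by blast
  have "inj_on g {..<n}" using emb_g dom_b by (simp add: emb_def atLeast0LessThan)
  then have "inj_on z {..<n}" using z(2) same_type_inj_on by blast
  then show ?thesis by (simp add: z(1) card_image)
qed

lemma e_subset_imp_eq: "e i \<subseteq> e j \<Longrightarrow> i = j"
  using card_subset_eq[OF finite_e, of "e i" j] inj_e by (simp add: card_e inj_eq)

text \<open>An empty \<open>b\<close> would have only one copy, against the injectivity of
  \<open>e\<close>.\<close>

lemma e_nonempty: "e i \<noteq> {}"
proof
  assume "e i = {}"
  then have "n = 0" using card_e[of i] by simp
  then have "e 0 = e 1" using card_e finite_e by (metis card_0_eq)
  then show False using inj_e by (simp add: inj_eq)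
qed

lemma decp_mem_e:
  assumes "rec_fun_rel orc f" "rec_fun_rel orc h"
  shows "decp orc (\<lambda>m. h m \<in> e (f m))"
proof -
  have code: "rec_fun_rel orc (\<lambda>i. fset_code (e i))"
    using enum rec_no_oracle unfolding rec_enum_norep_def by blast
  show ?thesis unfolding mem_iff_odd_fset_code[OF finite_e]
    by (intro decp_odd rec_div rec_power rec_const assms rec_comp[OF code])
qed

text \<open>The tuple \<open>y\<close> lists the images of \<open>k, k - 1, \<dots>, 0\<close>. Every copy of \<open>b\<close> among them that
  contains the most recent one must have an index below \<open>M\<close> and the colour \<open>col\<close>; the bound makes
  the condition decidable.\<close>

definition good :: "nat \<Rightarrow> (nat \<Rightarrow> nat) \<Rightarrow> nat \<Rightarrow> (nat \<Rightarrow> bool) \<Rightarrow> bool" where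
  "good k y M col \<longleftrightarrow> same_type ar X (Suc k) (\<lambda>a. k - a) y \<and>
     (\<forall>i. y 0 \<in> e i \<longrightarrow> e i \<subseteq> y ` {..<Suc k} \<longrightarrow> i < M \<and> col i)"

text \<open>The quantifier over all indices becomes one over the \<open>n\<close>-tuples of
  positions in \<open>y\<close>, coded by \<open>q\<close>. To find the index of a copy below
  \<open>M\<close> it is enough to test inclusion, since all copies have the same size.\<close>

lemma good_iff:
  "good k y M col \<longleftrightarrow> same_type ar X (Suc k) (\<lambda>a. k - a) y \<and>
     (\<forall>q<Suc k ^ n. same_type ar X n g (\<lambda>j. y (digit (Suc k) j q)) \<and>
        (\<exists>j<n. y (digit (Suc k) j q) = y 0) \<longrightarrow>
        (\<exists>i<M. col i \<and> (\<forall>j<n. y (digit (Suc k) j q) \<in> e i)))"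
    (is "_ \<longleftrightarrow> _ \<and> ?R")
proof -
  have "(\<forall>i. y 0 \<in> e i \<longrightarrow> e i \<subseteq> y ` {..<Suc k} \<longrightarrow> i < M \<and> col i) \<longleftrightarrow> ?R" (is "?L \<longleftrightarrow> _")
  proof
    assume ?L
    show ?R
    proof (intro allI impI, elim conjE)
      fix q assume "same_type ar X n g (\<lambda>j. y (digit (Suc k) j q))"
      then obtain i where i: "e i = (\<lambda>j. y (digit (Suc k) j q)) ` {..<n}" using ex_index by blast
      assume "\<exists>j<n. y (digit (Suc k) j q) = y 0"
      then have "y 0 \<in> e i" unfolding i by (metis image_eqI lessThan_iff)
      moreover have "e i \<subseteq> y ` {..<Suc k}" unfolding i using digit_less[of "Suc k"] by blast
      ultimately have "i < M" "col i" using \<open>?L\<close> by auto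
      then show "\<exists>i<M. col i \<and> (\<forall>j<n. y (digit (Suc k) j q) \<in> e i)" using i by blast
    qed
  next
    assume ?R
    show ?L
    proof (intro allI impI)
      fix i assume y0: "y 0 \<in> e i" and sub: "e i \<subseteq> y ` {..<Suc k}"
      obtain z where z: "e i = z ` {..<n}" "same_type ar X n g z" using ex_type_e by blast
      have "\<forall>j. \<exists>a. j < n \<longrightarrow> a < Suc k \<and> z j = y a" using sub unfolding z(1) by blast
      then obtain d where d: "\<And>j. j < n \<Longrightarrow> d j < Suc k \<and> z j = y (d j)" by metis
      obtain q where q: "q < Suc k ^ n" "\<forall>j<n. digit (Suc k) j q = d j"
        using ex_digits[of "map d [0..<n]" "Suc k"] d by (auto simp: image_subset_iff)
      have yq: "z j = y (digit (Suc k) j q)" if "j < n" for j using d q(2) that by simp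
      have "same_type ar X n g (\<lambda>j. y (digit (Suc k) j q))"
        using z(2) same_type_cong[of n g g z "\<lambda>j. y (digit (Suc k) j q)"] yq by simp
      moreover have "\<exists>j<n. y (digit (Suc k) j q) = y 0" using y0 yq unfolding z(1) by fastforce
      ultimately obtain i' where i': "i' < M" "col i'" "\<forall>j<n. y (digit (Suc k) j q) \<in> e i'"
        using \<open>?R\<close> q(1) by blast
      then have "e i \<subseteq> e i'" unfolding z(1) using yq by auto
      then have "i = i'" by (rule e_subset_imp_eq)
      with i' show "i < M \<and> col i" by simp
    qed
  qed
  then show ?thesis unfolding good_def by (rule arg_cong)
qed

lemma decp_good:
  assumes k: "rec_fun_rel orc k" and y: "rec_fun_rel orc (\<lambda>p. y (pfst p) (psnd p))"
    and M: "rec_fun_rel orc M" and col: "decp orc (\<lambda>p. col (pfst p) (psnd p))"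
  shows "decp orc (\<lambda>m. good (k m) (y m) (M m) (col m))"
proof -
  \<comment> \<open>Only the first \<open>n\<close> values of \<open>g\<close> matter, and they are
    computable from a finite code.\<close>
  obtain s where "\<forall>j<n. code_nth s j = g j" using ex_code_nth by blast
  then have s: "same_type ar X n g z \<longleftrightarrow> same_type ar X n (code_nth s) z" for z
    using same_type_cong[of n g "code_nth s" z z] by simp
  show ?thesis
    unfolding good_iff s
    by (intro decp_conj decp_imp decp_ball decp_bex decp_same_type[OF rec_X] decp_mem_e decp_eq
        rec_Suc rec_diff rec_power rec_digit rec_code_nth rec_const rec_comp[OF k] rec_comp[OF M]
        rec_app2[OF y] decp_app2[OF col] rec_pfst rec_psnd rec_id k M y)
qed

end

section \<open>Using complexity: one further point, then the whole embedding\<close>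

context enumerated_copies
begin

text \<open>The words for which no candidate \<open>x\<close> works form tests of arbitrarily small
  measure. For the fixed recursive \<open>y\<close> these tests are recursive, so the complex string
  leaves one of them.\<close>

lemma ex_good_extension:
  assumes type: "same_type ar X k (\<lambda>a. k - 1 - a) y" and y: "rec_fun_rel no_oracle y"
    and U: "universal_prefix U" and KC: "KC_string U \<epsilon>"
  shows "\<exists>x M. good k (case_nat x y) M \<epsilon>"
proof -
  define C where "C = {x. same_type ar X (Suc k) (\<lambda>a. k - a) (case_nat x y)}"
  have rev_eq: "(\<lambda>a. k - a) = case_nat k (\<lambda>a. k - 1 - a)"
    by (rule ext) (simp split: nat.split)
  have infC: "infinite C"
    unfolding C_def by (subst rev_eq) (rule infinite_realizations[OF dom_X hom dense type], simp)
  have C_new: "x \<notin> y ` {..<k}" if "x \<in> C" for x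
  proof
    assume "x \<in> y ` {..<k}"
    then obtain a where a: "a < k" "x = y a" by auto
    have "\<forall>a<Suc k. \<forall>b<Suc k. k - a = k - b \<longleftrightarrow> case_nat x y a = (case_nat x y b :: nat)"
      using that by (simp add: C_def same_type_def)
    from this[rule_format, of 0 "Suc a"] a show False by simp
  qed
  \<comment> \<open>Indices of the copies completed by adding \<open>x\<close>. There are at most as
    many as subsets of a set of \<open>k + 1\<close> points, whence \<open>t\<close>.\<close>
  define D where "D x = {i. x \<in> e i \<and> e i \<subseteq> case_nat x y ` {..<Suc k}}" for x
  define t where "t = (2::nat) ^ Suc k"
  have D: "finite (D x)" "card (D x) \<le> t" for x
  proof -
    let ?P = "Pow (case_nat x y ` {..<Suc k})"
    have "e ` D x \<subseteq> ?P" by (auto simp: D_def)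
    moreover have "inj_on e (D x)" using inj_e by (rule inj_on_subset) simp
    ultimately show "finite (D x)" and "card (D x) \<le> t"
      using inj_on_finite[of e "D x" ?P] card_inj_on_le[of e "D x" ?P]
        power_increasing[OF card_image_le[of "{..<Suc k}" "case_nat x y"], of "2::nat"]
      by (auto simp: card_Pow t_def)
  qed
  have D_disjoint: "D x \<inter> D x' = {}" if "x \<in> C" "x' \<in> C" "x \<noteq> x'" for x x'
  proof (rule ccontr)
    assume "D x \<inter> D x' \<noteq> {}"
    then have "x \<in> case_nat x' y ` {..<Suc k}" by (auto simp: D_def)
    with that(3) have "x \<in> y ` {..<k}" by (auto split: nat.splits)
    with C_new that(1) show False by blast
  qed

  \<comment> \<open>\<open>B N v\<close>: the word of length \<open>N\<close> with code
    \<open>v\<close> is bad. \<open>Suc v div 2 ^ i\<close> exposes its letter \<open>i\<close>;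
    bounding both \<open>x\<close> and the indices by \<open>N\<close> keeps this decidable.\<close>
  define B where "B N v \<longleftrightarrow> \<not> (\<exists>x<N. good k (case_nat x y) N (\<lambda>i. odd (Suc v div 2 ^ i)))" for N v
  have small: "\<exists>N. card {w. length w = N \<and> B N (wcode w)} * 2 ^ (2 * c + 1) \<le> 2 ^ N" for c
  proof -
    \<comment> \<open>\<open>s\<close> disjoint sets are enough to push the proportion of bad words
      below \<open>2 ^ (- (2 * c + 1))\<close>.\<close>
    obtain s where s: "((2::nat) ^ t - 1) ^ s * 2 ^ (2 * c + 1) \<le> (2 ^ t) ^ s"
      using ex_power_ratio_le[of "2 ^ t"] by auto
    obtain J where J: "J \<subseteq> C" "finite J" "card J = s"
      using infinite_arbitrarily_large[OF infC] by blast
    \<comment> \<open>\<open>N\<close> exceeds the chosen candidates and all indices in their sets,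
      so a bad word must have a 0 in each \<open>D x\<close>.\<close>
    have "finite (J \<union> (\<Union>x\<in>J. D x))" using J D by simp
    then obtain N where N: "J \<union> (\<Union>x\<in>J. D x) \<subseteq> {..<N}"
      unfolding finite_nat_set_iff_bounded by blast
    let ?W = "{w. length w = N \<and> B N (wcode w)}"
    let ?F = "{S. S \<subseteq> {..<N} \<and> (\<forall>x\<in>J. \<not> D x \<subseteq> S)}"
    have "(\<lambda>w. {i. i < N \<and> w ! i}) ` ?W \<subseteq> ?F"
    proof (intro image_subsetI CollectI conjI ballI notI)
      fix w x assume w: "w \<in> ?W" and x: "x \<in> J" and sub: "D x \<subseteq> {i. i < N \<and> w ! i}"
      have "good k (case_nat x y) N (\<lambda>i. odd (Suc (wcode w) div 2 ^ i))"
        unfolding good_def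
      proof (intro conjI allI impI)
        show "same_type ar X (Suc k) (\<lambda>a. k - a) (case_nat x y)" using x J(1) by (auto simp: C_def)
        fix i assume "case_nat x y 0 \<in> e i" "e i \<subseteq> case_nat x y ` {..<Suc k}"
        then have i: "i < N" "w ! i" using sub by (auto simp: D_def)
        then show "i < N" "odd (Suc (wcode w) div 2 ^ i)" using odd_Suc_wcode_div[of i w] w by auto
      qed
      moreover have "x < N" using N x by auto
      ultimately show False using w by (auto simp: B_def)
    qed auto
    moreover have "inj_on (\<lambda>w. {i. i < N \<and> w ! i}) ?W"
    proof (rule inj_onI)
      fix w w' assume "w \<in> ?W" "w' \<in> ?W" "{i. i < N \<and> w ! i} = {i. i < N \<and> w' ! i}"
      then show "w = w'" by (intro nth_equalityI) (auto simp: set_eq_iff)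
    qed
    moreover have "finite ?F" by (rule finite_subset[of _ "Pow {..<N}"]) auto
    ultimately have le: "card ?W \<le> card ?F" 
      by (intro card_inj_on_le[of "\<lambda>w. {i. i < N \<and> w ! i}"])
    have "card ?F * (2 ^ t) ^ card J \<le> 2 ^ card {..<N} * (2 ^ t - 1) ^ card J"
    proof (rule card_avoiding_disjoint)
      show "D x \<subseteq> {..<N}" if "x \<in> J" for x using N that by blast
      show "D x \<inter> D x' = {}" if "x \<in> J" "x' \<in> J" "x \<noteq> x'" for x x'
        using D_disjoint J(1) that by blast
    qed (use J D in simp_all)
    then have F: "card ?F * (2 ^ t) ^ s \<le> 2 ^ N * (2 ^ t - 1) ^ s" using J by simp
    have "(card ?W * 2 ^ (2 * c + 1)) * (2 ^ t) ^ s \<le> (card ?F * (2 ^ t) ^ s) * 2 ^ (2 * c + 1)"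
      using le by (simp add: mult.commute mult.left_commute del: power_Suc)
    also have "\<dots> \<le> (2 ^ N * (2 ^ t - 1) ^ s) * 2 ^ (2 * c + 1)"
      by (rule mult_right_mono[OF F]) simp
    also have "\<dots> \<le> 2 ^ N * (2 ^ t) ^ s"
      using mult_left_mono[OF s, of "2 ^ N"] by (simp only: mult.assoc)
    finally have "card ?W * 2 ^ (2 * c + 1) \<le> 2 ^ N"
      by (simp only: mult_le_cancel2 zero_less_power zero_less_numeral simp_thms)
    then show ?thesis by blast
  qed
  \<comment> \<open>Taking the least such length makes \<open>N\<close> recursive.\<close>
  define N where "N c = (LEAST N. card {w. length w = N \<and> B N (wcode w)} * 2 ^ (2 * c + 1) \<le> 2 ^ N)"
    for c
  have decB: "decp no_oracle (\<lambda>p. B (f p) (h p))"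
    if f: "rec_fun_rel no_oracle f" and h: "rec_fun_rel no_oracle h" for f h
  proof -
    have "decp no_oracle (\<lambda>p. \<exists>x<f p. good k (case_nat x y) (f p) (\<lambda>i. odd (Suc (h p) div 2 ^ i)))"
    proof (intro decp_bex f decp_good rec_const)
      have "case_nat x y j = of_bool (j = 0) * x + of_bool (j \<noteq> 0) * y (j - 1)" for x j
        by (cases j) auto
      then show "rec_fun_rel no_oracle (\<lambda>p. case_nat (psnd (pfst p)) y (psnd p))"
        by (simp only:) (intro rec_add rec_mult rec_of_bool decp_not decp_eq rec_const rec_diff
            rec_comp[OF y] rec_pfst rec_psnd rec_id)
    qed (intro decp_odd rec_div rec_Suc rec_power rec_const rec_comp[OF f] rec_comp[OF h]
        rec_pfst rec_psnd rec_id)+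
    then show ?thesis unfolding B_def by (rule decp_not)
  qed
  have N: "rec_fun_rel no_oracle N"
    unfolding N_def
  proof (rule rec_LEAST)
    show "decp no_oracle (\<lambda>p. card {w. length w = psnd p \<and> B (psnd p) (wcode w)} * 2 ^ (2 * pfst p + 1)
        \<le> 2 ^ psnd p)"
      unfolding card_words_eq_sum
      by (intro decp_le rec_mult rec_power rec_add rec_const rec_sum rec_of_bool decp_conj decp_less
          decB rec_Suc rec_pfst rec_psnd rec_id)
  qed (rule small)
  have "\<exists>c. \<not> B (N c) (wcode (init_seg \<epsilon> (N c)))"
  proof (rule KC_string_passes_test[OF N _ _ U KC])
    show "decp no_oracle (\<lambda>p. B (N (pfst p)) (psnd p))"
      by (intro decB rec_comp[OF N] rec_pfst rec_psnd rec_id)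
    show "card {w. length w = N c \<and> B (N c) (wcode w)} * 2 ^ (2 * c + 1) \<le> 2 ^ N c" for c
      unfolding N_def by (rule LeastI_ex[OF small])
  qed
  then obtain c x where x: "good k (case_nat x y) (N c)
      (\<lambda>i. odd (Suc (wcode (init_seg \<epsilon> (N c))) div 2 ^ i))"
    unfolding B_def by blast
  \<comment> \<open>\<open>good\<close> forces all relevant indices below \<open>N c\<close>, where
    the word and \<epsilon> agree.\<close>
  moreover have "odd (Suc (wcode (init_seg \<epsilon> (N c))) div 2 ^ i) \<longleftrightarrow> \<epsilon> i" if "i < N c" for i
    using odd_Suc_wcode_div[of i "init_seg \<epsilon> (N c)"] that by (simp add: init_seg_def)
  ultimately have "good k (case_nat x y) (N c) \<epsilon>"
    unfolding good_def by blast
  then show ?thesis by blast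
qed

lemma ex_monochromatic_embedding:
  assumes U: "universal_prefix U" and KC: "KC_string U \<epsilon>"
  shows "\<exists>\<nu>. emb ar X X \<nu> \<and> rec_fun_rel (str_oracle \<epsilon>) \<nu> \<and>
    (\<forall>i. e i \<in> copies ar X (range \<nu>) b \<longrightarrow> \<epsilon> i)"
proof -
  \<comment> \<open>\<open>u\<close> codes the next value together with a bound on the indices. The
    premise makes the search total: it stops at once on states \<open>s\<close> of the wrong type,
    which never arise.\<close>
  define step where "step k s = (LEAST u. same_type ar X k (\<lambda>a. k - 1 - a) (code_nth s) \<longrightarrow>
      good k (code_nth (pair (pfst u) s)) (psnd u) \<epsilon>)" for k s
  define st where "st k = rec_nat 0 (\<lambda>k s. pair (pfst (step k s)) s) k" for k
  define \<nu> where "\<nu> k = pfst (step k (st k))" for k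
  have st: "st 0 = 0" "st (Suc k) = pair (\<nu> k) (st k)" for k
    by (simp_all add: st_def \<nu>_def)
  have ex_step: "\<exists>u. same_type ar X k (\<lambda>a. k - 1 - a) (code_nth s) \<longrightarrow>
      good k (code_nth (pair (pfst u) s)) (psnd u) \<epsilon>" for k s
  proof (cases "same_type ar X k (\<lambda>a. k - 1 - a) (code_nth s)")
    case True
    have "rec_fun_rel no_oracle (code_nth s)" using rec_code_nth[OF rec_const rec_id] .
    from ex_good_extension[OF True this U KC] obtain x M where "good k (case_nat x (code_nth s)) M \<epsilon>"
      by blast
    then show ?thesis by (intro exI[of _ "pair x M"]) (simp add: code_nth_pair)
  qed simp
  have good: "good k (code_nth (st (Suc k))) (psnd (step k (st k))) \<epsilon>"
    if "same_type ar X k (\<lambda>a. k - 1 - a) (code_nth (st k))" for k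
    using LeastI_ex[OF ex_step[of k "st k"]] that unfolding step_def[symmetric] st \<nu>_def by blast
  have type: "same_type ar X k (\<lambda>a. k - 1 - a) (code_nth (st k))" for k
  proof (induction k)
    case 0
    show ?case using same_type_cong[of 0 _ "\<lambda>a. a" _ "\<lambda>a. a"] same_type_refl by blast
  next
    case (Suc k)
    from good[OF this] show ?case by (simp add: good_def)
  qed
  have code_st: "a < k \<Longrightarrow> code_nth (st k) a = \<nu> (k - 1 - a)" for a k
    by (induction k arbitrary: a) (auto simp: st code_nth_pair split: nat.split)
  \<comment> \<open>The state lists the values in reverse order; reversing once more gives the type
    of \<nu> itself.\<close>
  have type_\<nu>: "same_type ar X k (\<lambda>a. a) \<nu>" for k
  proof -
    have "same_type ar X k (\<lambda>a. k - 1 - (k - 1 - a)) (\<lambda>a. code_nth (st k) (k - 1 - a))"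
      by (rule same_type_comp[OF type]) auto
    then show ?thesis
      using same_type_cong[of k "\<lambda>a. k - 1 - (k - 1 - a)" "\<lambda>a. a"
          "\<lambda>a. code_nth (st k) (k - 1 - a)" \<nu>] by (simp add: code_st)
  qed
  have inj_\<nu>: "inj \<nu>"
  proof (rule injI)
    fix x y assume "\<nu> x = \<nu> y"
    moreover have "x = y \<longleftrightarrow> \<nu> x = \<nu> y"
      using type_\<nu>[of "Suc (max x y)"] unfolding same_type_def by (simp add: less_Suc_eq_le)
    ultimately show "x = y" by simp
  qed
  have "snd X i xs \<longleftrightarrow> snd X i (map \<nu> xs)" if i: "i < length ar" "length xs = ar ! i" for i xs
  proof -
    obtain k where "set xs \<subseteq> {..<k}" 
      using finite_set[of xs] unfolding finite_nat_set_iff_bounded by blast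
    with type_\<nu>[of k] i have "snd X i (map (\<lambda>a. a) xs) \<longleftrightarrow> snd X i (map \<nu> xs)"
      unfolding same_type_def by blast
    then show ?thesis by simp
  qed
  with inj_\<nu> have "emb ar X X \<nu>" unfolding emb_def dom_X by blast
  moreover have "rec_fun_rel (str_oracle \<epsilon>) \<nu>"
  proof -
    have "eval (str_oracle \<epsilon>) COrc [m] (of_bool (\<epsilon> m))" for m
      using ev_orc[of "[m]" "str_oracle \<epsilon>"] by (simp add: str_oracle_def of_bool_def)
    then have \<epsilon>: "decp (str_oracle \<epsilon>) \<epsilon>" unfolding decp_def rec_fun_rel_def by blast
    have step: "rec_fun_rel (str_oracle \<epsilon>) (\<lambda>p. step (pfst p) (psnd p))"
      unfolding step_def
      by (rule rec_LEAST[OF _ ex_step])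
        (intro decp_imp decp_good decp_same_type[OF rec_X] decp_comp[OF \<epsilon>] rec_code_nth rec_pair
          rec_diff rec_const rec_pfst rec_psnd rec_id)
    have "rec_fun_rel (str_oracle \<epsilon>) st"
      unfolding st_def
      by (intro rec_rec_nat rec_pair rec_app2[OF step] rec_const rec_pfst rec_psnd rec_id)
    then show ?thesis
      unfolding \<nu>_def by (intro rec_pfst rec_app2[OF step] rec_id)
  qed
  moreover have "\<epsilon> i" if "e i \<in> copies ar X (range \<nu>) b" for i
  proof -
    have sub: "e i \<subseteq> range \<nu>" using that unfolding copies_iff by blast
    \<comment> \<open>A copy in the range of \<nu> is completed when the value at
      \<open>Max S\<close> is added. At that stage its newest point is entry 0 of the state, so
      \<open>good\<close> controls its colour.\<close>
    define S where "S = \<nu> -` e i"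
    have S: "\<nu> ` S = e i" using sub by (auto simp: S_def)
    have "finite S" unfolding S_def by (rule finite_vimageI[OF finite_e inj_\<nu>])
    moreover have "S \<noteq> {}" using S e_nonempty by blast
    ultimately have k: "Max S \<in> S" "\<And>a. a \<in> S \<Longrightarrow> a \<le> Max S" by auto
    let ?y = "code_nth (st (Suc (Max S)))"
    have "?y 0 \<in> e i" using k(1) S by (auto simp: code_st)
    moreover have "e i \<subseteq> ?y ` {..<Suc (Max S)}"
    proof
      fix x assume "x \<in> e i"
      then obtain a where a: "a \<in> S" "x = \<nu> a" using S by blast
      then have "x = ?y (Max S - a)" using k(2)[of a] by (simp add: code_st)
      then show "x \<in> ?y ` {..<Suc (Max S)}" by simp
    qed
    ultimately show ?thesis using good[OF type] unfolding good_def by blast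
  qed
  ultimately show ?thesis by blast
qed

end

theorem theorem2:
  fixes ar :: "nat list" and X :: struc and b :: struc and e :: "nat \<Rightarrow> nat set"
    and U :: "bool list \<Rightarrow> bool list option" and \<epsilon> :: "nat \<Rightarrow> bool"
  assumes "\<forall>a \<in> set ar. a \<ge> 1"
    and "is_struc ar X" and "recursive_struc ar X"
    and "homogeneous ar X" and "age_dense ar X"
    and "b \<in> Age ar X"
    and "rec_enum_norep e (copies ar X UNIV b)"
    and "universal_prefix U"
    and "KC_string U \<epsilon>"
  shows "\<exists>\<nu>. emb ar X X \<nu> \<and> rec_fun_rel (str_oracle \<epsilon>) \<nu> \<and>
           (\<forall>i. e i \<in> copies ar X (range \<nu>) b \<longrightarrow> \<epsilon> i)"
proof -
  obtain n g where "fst b = {0..<n}" "emb ar b X g"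
    using assms(6) by (auto simp: Age_def)
  then interpret enumerated_copies ar X b e n g
    using assms by unfold_locales
  show ?thesis using assms(8,9) by (rule ex_monochromatic_embedding)
qed

end
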